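(* Let $c_1,c_2>0$, $p>1$, $\bar t>0$, and let $I$ be a random variable (i.e. $\mathcal F$-measurable, not necessarily adapted or independent of $W$) with $I>0$. Set $$A_{\bar t}=\Big\{ I^{1-p}-c_1(p-1)\bar t-c_2(p-1)\sup_{0\le s\le \bar t}W_s>0\Big\}.$$ Then for every $t\in(0,\bar t\,]$ the process $$s\mapsto \left(I^{1-p}-c_1(p-1)s-c_2(p-1)W_s\right)^{\frac{p}{1-p}},\qquad s\in[0,t],$$ belongs to $\mathrm{Dom}\,\delta^-_{t,\mathrm{loc}}$ on the set $A_{\bar t}$. Furthermore, for $$L^x_t=\left(\left(\tfrac1x\right)^{p-1}-c_1(p-1)t-c_2(p-1)W_t\right)^{\frac{1}{1-p}},\qquad t\ge 0,\ x>0,$$ and $L^I_t=L^x_t|_{x=I}$, one has for every $t\le\bar t$ that the equation $$L^{I}_t=I+\int_0^t\left(c_1\left(L^{I}_s\right)^p+\frac{p\,c_2^2}{2}\left(L_s^{I}\right)^{2p-1}\right)ds+\int_0^t c_2\left(L_s^{I}\right)^p\,d^-W_s$$ is well defined on $A_{\bar t}$ (all terms make sense on $A_{\bar t}$, and the equality holds a.s. on $A_{\bar t}$), where the last integral is the (local) forward integral.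
   Context: $W=(W_t)_{t\ge0}$ is a standard Brownian motion on a filtered probability space $(\Omega,\mathcal F,\{\mathcal F_t\}_{t\ge0},P)$ whose filtration satisfies the usual conditions. Forward integral. Let $T>0$ and let $v$ be a measurable process with integrable trajectories on $[0,T]$. One says $v$ is forward integrable, $v\in\mathrm{Dom}\,\delta_T^-$, if $\frac1\epsilon\int_0^T v_s\,(W_{(s+\epsilon)\wedge T}-W_s)\,ds$ converges in probability as $\epsilon\downarrow0$; the limit is denoted $\int_0^T v_s\,d^-W_s$. Local forward integral. A process $v$ is locally forward integrable on a measurable set $A\in\mathcal F$, $v\in\mathrm{Dom}\,\delta^-_{T,\mathrm{loc}}$ on $A$, if there is a sequence $\{(v^n,A_n)\}_{n\in\mathbb N}$ in $\mathrm{Dom}\,\delta_T^-\times\mathcal F$ such that (i) $A_n\nearrow A$ a.s., and (ii) $v=v^n$ a.s. on $A_n\times[0,T]$. In that case one sets $\int_0^T v_s\,d^-W_s:=\int_0^T v^n_s\,d^-W_s$ on $A_n$. (This does not depend on the localizing sequence, because if $u,v\in\mathrm{Dom}\,\delta_T^-$ are measurable and $u=v$ a.s. on $A\times[0,T]$, then their forward integrals agree a.s. on $A$.) The values of the processes outside $A_{\bar t}$ are irrelevant. *)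

theory Defs
  imports "HOL-Probability.Probability"
begin

text \<open>Processes have type \<^typ>\<open>real \<Rightarrow> 'a \<Rightarrow> real\<close>, time first. The time axis is
  \<open>[0, \<infinity>)\<close>; values of \<open>F\<close> and \<open>W\<close> at negative times are unconstrained.\<close>

locale usual_filtered_prob_space = prob_space M + complete_measure M
  for M :: "'a measure" +
  fixes F :: "real \<Rightarrow> 'a measure"
  assumes subalgebra_F: "\<And>t. 0 \<le> t \<Longrightarrow> subalgebra M (F t)"
    and F_mono: "\<And>s t. 0 \<le> s \<Longrightarrow> s \<le> t \<Longrightarrow> sets (F s) \<subseteq> sets (F t)"
    and F_right_continuous: "\<And>t. 0 \<le> t \<Longrightarrow> (\<Inter>u\<in>{t<..}. sets (F u)) = sets (F t)"
    and F_null: "null_sets M \<subseteq> sets (F 0)"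

locale brownian_motion = usual_filtered_prob_space M F
  for M :: "'a measure" and F :: "real \<Rightarrow> 'a measure" +
  fixes W :: "real \<Rightarrow> 'a \<Rightarrow> real"
  assumes W_adapted: "\<And>t. 0 \<le> t \<Longrightarrow> W t \<in> borel_measurable (F t)"
    and W_zero: "AE \<omega> in M. W 0 \<omega> = 0"
    and W_continuous: "AE \<omega> in M. continuous_on {0..} (\<lambda>t. W t \<omega>)"
    and W_indep: "\<And>s t. 0 \<le> s \<Longrightarrow> s < t \<Longrightarrow>
      indep_set (sets (F s)) (sets (vimage_algebra (space M) (\<lambda>\<omega>. W t \<omega> - W s \<omega>) borel))"
    and W_normal: "\<And>s t. 0 \<le> s \<Longrightarrow> s < t \<Longrightarrow>
      distributed M lborel (\<lambda>\<omega>. W t \<omega> - W s \<omega>) (normal_density 0 (sqrt (t - s)))"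

text \<open>Measurability is demanded of the family and of the limit because
  \<^const>\<open>measure\<close> is \<open>0\<close> on sets that are not measurable.\<close>

definition tendsto_in_prob ::
  "'a measure \<Rightarrow> ('i \<Rightarrow> 'a \<Rightarrow> real) \<Rightarrow> ('a \<Rightarrow> real) \<Rightarrow> 'i filter \<Rightarrow> bool" where
  "tendsto_in_prob M X Z G \<longleftrightarrow>
     Z \<in> borel_measurable M \<and> (\<forall>\<^sub>F i in G. X i \<in> borel_measurable M) \<and>
     (\<forall>\<delta>>0. ((\<lambda>i. measure M {\<omega> \<in> space M. \<delta> < \<bar>X i \<omega> - Z \<omega>\<bar>}) \<longlongrightarrow> 0) G)"

definition forward_approx ::
  "(real \<Rightarrow> 'a \<Rightarrow> real) \<Rightarrow> real \<Rightarrow> (real \<Rightarrow> 'a \<Rightarrow> real) \<Rightarrow> real \<Rightarrow> 'a \<Rightarrow> real" where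
  "forward_approx W T v \<epsilon> \<omega> =
     (1 / \<epsilon>) * (LINT s:{0..T}|lborel. v s \<omega> * (W (min (s + \<epsilon>) T) \<omega> - W s \<omega>))"

text \<open>For \<open>T = 0\<close> the approximations, and hence the forward integral, are zero.\<close>

definition has_forward_integral ::
  "'a measure \<Rightarrow> (real \<Rightarrow> 'a \<Rightarrow> real) \<Rightarrow> real \<Rightarrow> (real \<Rightarrow> 'a \<Rightarrow> real) \<Rightarrow> ('a \<Rightarrow> real) \<Rightarrow> bool" where
  "has_forward_integral M W T v Z \<longleftrightarrow>
     (\<lambda>(s, \<omega>). v s \<omega>) \<in> borel_measurable (restrict_space borel {0..T} \<Otimes>\<^sub>M M) \<and>
     (\<forall>\<omega>\<in>space M. set_integrable lborel {0..T} (\<lambda>s. v s \<omega>)) \<and>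
     tendsto_in_prob M (forward_approx W T v) Z (at_right 0)"

definition forward_integrable ::
  "'a measure \<Rightarrow> (real \<Rightarrow> 'a \<Rightarrow> real) \<Rightarrow> real \<Rightarrow> (real \<Rightarrow> 'a \<Rightarrow> real) \<Rightarrow> bool" where
  "forward_integrable M W T v \<longleftrightarrow> (\<exists>Z. has_forward_integral M W T v Z)"

text \<open>The limit in probability is only determined up to almost sure equality;
  \<open>forward_integral\<close> is some version of it.\<close>

definition forward_integral ::
  "'a measure \<Rightarrow> (real \<Rightarrow> 'a \<Rightarrow> real) \<Rightarrow> real \<Rightarrow> (real \<Rightarrow> 'a \<Rightarrow> real) \<Rightarrow> 'a \<Rightarrow> real" where
  "forward_integral M W T v = (SOME Z. has_forward_integral M W T v Z)"

definition forward_localizing ::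
  "'a measure \<Rightarrow> (real \<Rightarrow> 'a \<Rightarrow> real) \<Rightarrow> real \<Rightarrow> 'a set \<Rightarrow> (real \<Rightarrow> 'a \<Rightarrow> real) \<Rightarrow>
   (nat \<Rightarrow> real \<Rightarrow> 'a \<Rightarrow> real) \<Rightarrow> (nat \<Rightarrow> 'a set) \<Rightarrow> bool" where
  "forward_localizing M W T A v vn An \<longleftrightarrow>
     (\<forall>n. forward_integrable M W T (vn n) \<and> An n \<in> sets M) \<and>
     (AE \<omega> in M. (\<forall>n. \<omega> \<in> An n \<longrightarrow> \<omega> \<in> An (Suc n)) \<and> (\<omega> \<in> A \<longleftrightarrow> (\<exists>n. \<omega> \<in> An n))) \<and>
     (\<forall>n. AE (s, \<omega>) in lborel \<Otimes>\<^sub>M M. s \<in> {0..T} \<and> \<omega> \<in> An n \<longrightarrow> v s \<omega> = vn n s \<omega>)"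

definition locally_forward_integrable ::
  "'a measure \<Rightarrow> (real \<Rightarrow> 'a \<Rightarrow> real) \<Rightarrow> real \<Rightarrow> 'a set \<Rightarrow> (real \<Rightarrow> 'a \<Rightarrow> real) \<Rightarrow> bool" where
  "locally_forward_integrable M W T A v \<longleftrightarrow>
     A \<in> sets M \<and> (\<exists>vn An. forward_localizing M W T A v vn An)"

definition has_local_forward_integral ::
  "'a measure \<Rightarrow> (real \<Rightarrow> 'a \<Rightarrow> real) \<Rightarrow> real \<Rightarrow> 'a set \<Rightarrow> (real \<Rightarrow> 'a \<Rightarrow> real) \<Rightarrow>
   ('a \<Rightarrow> real) \<Rightarrow> bool" where
  "has_local_forward_integral M W T A v Z \<longleftrightarrow>
     A \<in> sets M \<and>
     (\<exists>vn An. forward_localizing M W T A v vn An \<and>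
       (\<forall>n. AE \<omega> in M. \<omega> \<in> An n \<longrightarrow> Z \<omega> = forward_integral M W T (vn n) \<omega>))"

text \<open>Only the values on \<open>A\<close>, up to a null set, are meaningful.\<close>

definition local_forward_integral ::
  "'a measure \<Rightarrow> (real \<Rightarrow> 'a \<Rightarrow> real) \<Rightarrow> real \<Rightarrow> 'a set \<Rightarrow> (real \<Rightarrow> 'a \<Rightarrow> real) \<Rightarrow> 'a \<Rightarrow> real" where
  "local_forward_integral M W T A v = (SOME Z. has_local_forward_integral M W T A v Z)"

definition survival_set ::
  "'a measure \<Rightarrow> (real \<Rightarrow> 'a \<Rightarrow> real) \<Rightarrow> real \<Rightarrow> real \<Rightarrow> real \<Rightarrow> ('a \<Rightarrow> real) \<Rightarrow> real \<Rightarrow> 'a set" where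
  "survival_set M W c\<^sub>1 c\<^sub>2 p I tbar =
     {\<omega> \<in> space M. I \<omega> powr (1 - p) - c\<^sub>1 * (p - 1) * tbar
        - c\<^sub>2 * (p - 1) * (SUP s\<in>{0..tbar}. W s \<omega>) > 0}"

definition L_base ::
  "(real \<Rightarrow> 'a \<Rightarrow> real) \<Rightarrow> real \<Rightarrow> real \<Rightarrow> real \<Rightarrow> real \<Rightarrow> real \<Rightarrow> 'a \<Rightarrow> real" where
  "L_base W c\<^sub>1 c\<^sub>2 p x t \<omega> = (1 / x) powr (p - 1) - c\<^sub>1 * (p - 1) * t - c\<^sub>2 * (p - 1) * W t \<omega>"

text \<open>\<open>L W c\<^sub>1 c\<^sub>2 p x t\<close> is the random variable \<open>L\<^sup>x\<^sub>t\<close>; it is meaningful where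
  \<^const>\<open>L_base\<close> is positive.\<close>

definition L ::
  "(real \<Rightarrow> 'a \<Rightarrow> real) \<Rightarrow> real \<Rightarrow> real \<Rightarrow> real \<Rightarrow> real \<Rightarrow> real \<Rightarrow> 'a \<Rightarrow> real" where
  "L W c\<^sub>1 c\<^sub>2 p x t \<omega> = L_base W c\<^sub>1 c\<^sub>2 p x t \<omega> powr (1 / (1 - p))"

end

theory Submission
  imports Defs
begin

text \<open>
  The forward integral makes sense for anticipating integrands because it is a limit of ordinary
  integrals, and on the survival set everything can be done path by path. Write
  \<open>X\<^sub>s = I\<^sup>1\<^sup>-\<^sup>p - c\<^sub>1 (p - 1) s - c\<^sub>2 (p - 1) W\<^sub>s\<close>. On the survival set each path of \<open>X\<close> is continuous and
  positive on \<open>[0, tbar]\<close>, hence bounded away from zero, and \<open>L = f (X)\<close> for the function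
  \<open>f z = z powr (1 / (1 - p))\<close>, which is smooth on the range of \<open>X\<close>. The equation for \<open>L\<close> is Ito's
  formula for \<open>f (X)\<close>; since \<open>I\<close> may depend on the whole path of \<open>W\<close>, it has to be proved without
  martingale arguments.

  The probabilistic input is that the quadratic variation
  \<open>1 / \<epsilon> * \<integral> (W ((s + \<epsilon>) \<and> T) - W s)\<^sup>2 ds\<close> over \<open>[0, u]\<close> converges to \<open>u\<close>. Its second moment around
  the mean is of order \<open>\<epsilon>\<close>, because squared increments over disjoint intervals are uncorrelated
  (\<open>compensated_squares_second_moment_bound\<close>). Along summable sequences of \<open>\<epsilon>\<close> the convergence is
  therefore almost sure, simultaneously for countably many \<open>u\<close>, and for each such path it extends to
  integrals against arbitrary continuous weights, which may depend on the path in any way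
  (\<open>AE_weighted_quadratic_variation\<close>). For such a path, Taylor's formula gives Ito's formula with
  the limit of the forward approximations as its stochastic integral (\<open>pathwise_ito\<close>,
  \<open>pathwise_power_ito\<close>).

  Almost sure convergence along all summable sequences implies convergence in probability as \<open>\<epsilon>\<close>
  decreases to \<open>0\<close> (\<open>has_forward_integral_pathwiseI\<close>). So the integrand multiplied by the indicator
  of the survival set is forward integrable, and the constant localizing sequence consisting of
  this process and the survival set is admissible. As the local forward integral does not depend on the
  localizing sequence (\<open>has_local_forward_integral_unique\<close>), it is the limit that was computed.
\<close>

section \<open>Pathwise calculus along vanishing time steps\<close>

lemma set_integral_continuous_eq_integral:
  fixes f :: "real \<Rightarrow> real"
  assumes "continuous_on {a..b} f"
  shows "(LINT s:{a..b}|lborel. f s) = integral {a..b} f"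
  using borel_integrable_atLeastAtMost'[OF assms] by (rule set_borel_integral_eq_integral)

text \<open>Replacing \<open>y\<close> by its value at the left end of each cell of a uniform grid costs at most its
  oscillation on a cell times the total mass of \<open>q\<close>; induction on the number of cells.\<close>

lemma riemann_sum_weighted_error:
  fixes y q :: "real \<Rightarrow> real" and T :: real and N :: nat
  assumes T: "0 \<le> T" and N: "0 < N"
    and y: "continuous_on {0..T} y" and q: "continuous_on {0..T} q"
    and q_nonneg: "\<And>s. s \<in> {0..T} \<Longrightarrow> 0 \<le> q s"
    and osc: "\<And>s r. s \<in> {0..T} \<Longrightarrow> r \<in> {0..T} \<Longrightarrow> \<bar>s - r\<bar> \<le> T / N \<Longrightarrow> \<bar>y s - y r\<bar> \<le> e"
    and "k \<le> N"
  shows "\<bar>integral {0..k * T / N} (\<lambda>s. y s * q s)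
           - (\<Sum>j<k. y (j * T / N) * (integral {0..real (Suc j) * T / N} q - integral {0..j * T / N} q))\<bar>
         \<le> e * integral {0..k * T / N} q"
  using \<open>k \<le> N\<close>
proof (induction k)
  case 0
  then show ?case by simp
next
  case (Suc k)
  define a b where "a = k * T / N" and "b = real (Suc k) * T / N"
  have ab: "0 \<le> a" "a \<le> b" "b \<le> T" "b - a = T / N"
    using T N Suc.prems mult_right_mono[of "1 + real k" "real N" T]
    by (auto simp: a_def b_def field_simps)
  have sub: "{0..b} \<subseteq> {0..T}" "{a..b} \<subseteq> {0..T}" using ab by auto
  have yq: "continuous_on {0..T} (\<lambda>s. y s * q s)" using y q by (intro continuous_intros)
  have split1: "integral {0..b} (\<lambda>s. y s * q s)
      = integral {0..a} (\<lambda>s. y s * q s) + integral {a..b} (\<lambda>s. y s * q s)"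
    by (rule Henstock_Kurzweil_Integration.integral_combine[symmetric])
      (use ab sub yq in \<open>auto intro!: integrable_continuous_interval intro: continuous_on_subset\<close>)
  have split2: "integral {0..b} q = integral {0..a} q + integral {a..b} q"
    by (rule Henstock_Kurzweil_Integration.integral_combine[symmetric])
      (use ab sub q in \<open>auto intro!: integrable_continuous_interval intro: continuous_on_subset\<close>)
  have q_ab: "continuous_on {a..b} q" and y_ab: "continuous_on {a..b} y"
    using sub q y by (auto intro: continuous_on_subset)
  have "norm (integral {a..b} (\<lambda>s. (y s - y a) * q s)) \<le> integral {a..b} (\<lambda>s. e * q s)"
  proof (rule integral_norm_bound_integral)
    show "(\<lambda>s. (y s - y a) * q s) integrable_on {a..b}" "(\<lambda>s. e * q s) integrable_on {a..b}"
      using q_ab y_ab by (auto intro!: integrable_continuous_interval continuous_intros)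
    fix s assume s: "s \<in> {a..b}"
    have "\<bar>y s - y a\<bar> \<le> e" using s ab sub by (intro osc) auto
    moreover have "0 \<le> q s" using s sub by (intro q_nonneg) auto
    ultimately show "norm ((y s - y a) * q s) \<le> e * q s"
      by (auto simp: abs_mult intro!: mult_right_mono)
  qed
  moreover have "integral {a..b} (\<lambda>s. (y s - y a) * q s)
      = integral {a..b} (\<lambda>s. y s * q s) - y a * integral {a..b} q"
    unfolding left_diff_distrib using q_ab y_ab
    by (subst Henstock_Kurzweil_Integration.integral_diff)
      (auto intro!: integrable_continuous_interval continuous_intros)
  ultimately have "\<bar>integral {a..b} (\<lambda>s. y s * q s) - y a * integral {a..b} q\<bar>
      \<le> e * integral {a..b} q" by simp
  moreover have "\<bar>integral {0..a} (\<lambda>s. y s * q s)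
           - (\<Sum>j<k. y (j * T / N) * (integral {0..real (Suc j) * T / N} q - integral {0..j * T / N} q))\<bar>
         \<le> e * integral {0..a} q"
    using Suc unfolding a_def by simp
  ultimately show ?case
    unfolding sum.lessThan_Suc a_def[symmetric] b_def[symmetric] split1 split2 distrib_left add_diff_cancel_left'
    by linarith
qed

text \<open>The measures with densities \<open>q n\<close> converge weakly to Lebesgue measure once their distribution
  functions converge at all grid points. In the application \<open>q n\<close> is random while the weight \<open>y\<close> is
  chosen afterwards, path by path, so that \<open>y\<close> may anticipate the future. Hence the hypothesis
  involves only countably many points: it can be secured almost surely.\<close>

lemma weighted_integral_tendsto:
  fixes y :: "real \<Rightarrow> real" and q :: "nat \<Rightarrow> real \<Rightarrow> real"
  assumes T: "0 \<le> T" and y: "continuous_on {0..T} y"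
    and q: "\<And>n. continuous_on {0..T} (q n)"
    and q_nonneg: "\<And>n s. s \<in> {0..T} \<Longrightarrow> 0 \<le> q n s"
    and grid: "\<And>(k :: nat) (N :: nat). 0 < N \<Longrightarrow> k \<le> N \<Longrightarrow>
      (\<lambda>n. integral {0..real k * T / real N} (q n)) \<longlonglongrightarrow> real k * T / real N"
  shows "(\<lambda>n. integral {0..T} (\<lambda>s. y s * q n s)) \<longlonglongrightarrow> integral {0..T} y"
proof (rule tendstoI)
  fix r :: real assume r: "0 < r"
  \<comment> \<open>The two Riemann sum errors are at most \<open>e * (T + 1)\<close> and \<open>e * T\<close>, the difference of the sums below \<open>e\<close>.\<close>
  define e where "e = r / (2 * T + 3)"
  have e: "0 < e" using r T by (auto simp: e_def)
  have "uniformly_continuous_on {0..T} y"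
    using y by (intro compact_uniformly_continuous) auto
  then obtain d where d: "0 < d"
    and dy: "\<And>s r. s \<in> {0..T} \<Longrightarrow> r \<in> {0..T} \<Longrightarrow> dist r s < d \<Longrightarrow> dist (y r) (y s) < e"
    using e unfolding uniformly_continuous_on_def by metis
  obtain N0 where N0: "T / d < real N0" using reals_Archimedean2 by blast
  define N where "N = Suc N0"
  have N: "0 < N" "T / N < d" using N0 d T by (auto simp: N_def field_simps)
  have osc: "\<bar>y s - y r\<bar> \<le> e" if "s \<in> {0..T}" "r \<in> {0..T}" "\<bar>s - r\<bar> \<le> T / N" for s r
    using dy[of r s] that N by (auto simp: dist_real_def)
  define t where "t j = real j * T / N" for j
  have tN: "t N = T" using N by (simp add: t_def)
  define S where "S f = (\<Sum>j<N. y (t j) * (integral {0..t (Suc j)} f - integral {0..t j} f))"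
    for f :: "real \<Rightarrow> real"
  have err: "\<bar>integral {0..T} (\<lambda>s. y s * f s) - S f\<bar> \<le> e * integral {0..T} f"
    if "continuous_on {0..T} f" "\<And>s. s \<in> {0..T} \<Longrightarrow> 0 \<le> f s" for f
    using riemann_sum_weighted_error[OF T N(1) y that osc order_refl] N
    unfolding S_def t_def by simp
  have grid': "(\<lambda>n. integral {0..t j} (q n)) \<longlonglongrightarrow> t j" if "j \<le> N" for j
    using grid[OF N(1) that] unfolding t_def .
  have id: "integral {0..t j} (\<lambda>s. 1) = t j" for j
    using T by (simp add: t_def)
  have "(\<lambda>n. S (q n)) \<longlonglongrightarrow> S (\<lambda>s. 1)"
    unfolding S_def id by (intro tendsto_intros grid') auto
  then have "eventually (\<lambda>n. dist (S (q n)) (S (\<lambda>s. 1)) < e) sequentially"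
    using e by (rule tendstoD)
  moreover have "eventually (\<lambda>n. dist (integral {0..T} (q n)) T < 1) sequentially"
    using grid'[of N] unfolding tN by (intro tendstoD) auto
  ultimately show "eventually (\<lambda>n. dist (integral {0..T} (\<lambda>s. y s * q n s)) (integral {0..T} y) < r)
    sequentially"
  proof eventually_elim
    case (elim n)
    have "\<bar>integral {0..T} (\<lambda>s. y s * q n s) - S (q n)\<bar> \<le> e * integral {0..T} (q n)"
      using err[OF q q_nonneg] by auto
    also have "\<dots> \<le> e * (T + 1)"
      using elim e by (intro mult_left_mono) (auto simp: dist_real_def)
    finally have 1: "\<bar>integral {0..T} (\<lambda>s. y s * q n s) - S (q n)\<bar> \<le> e * (T + 1)" .
    have 2: "\<bar>integral {0..T} y - S (\<lambda>s. 1)\<bar> \<le> e * T"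
      using err[of "\<lambda>s. 1"] T by simp
    have "dist (integral {0..T} (\<lambda>s. y s * q n s)) (integral {0..T} y) < e * (T + 1) + e + e * T"
      using 1 2 elim by (auto simp: dist_real_def)
    also have "\<dots> = e * (2 * T + 2)" by (simp add: algebra_simps)
    also have "\<dots> \<le> e * (2 * T + 3)" using e by simp
    also have "\<dots> = r" using T by (simp add: e_def)
    finally show ?case .
  qed
qed

text \<open>With a primitive \<open>G\<close> of \<open>g\<close> the integral equals the difference of the difference quotients of \<open>G\<close>
  at \<open>T\<close> and at \<open>0\<close>.\<close>

lemma integral_shift_quotient_tendsto:
  fixes g :: "real \<Rightarrow> real"
  assumes T: "0 \<le> T" and g: "continuous_on UNIV g"
  shows "((\<lambda>\<epsilon>. integral {0..T} (\<lambda>s. (g (s + \<epsilon>) - g s) / \<epsilon>)) \<longlongrightarrow> g T - g 0) (at_right 0)"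
proof -
  \<comment> \<open>Starting at \<open>- 1\<close> makes \<open>G\<close> differentiable at \<open>0\<close> from both sides.\<close>
  define G where "G u = integral {- 1..u} g" for u
  have G: "(G has_real_derivative g u) (at u)" if "- 1 < u" for u
  proof -
    have "(G has_real_derivative g u) (at u within {- 1..u + 1})"
      unfolding G_def has_real_derivative_iff_has_vector_derivative
      using that by (intro integral_has_vector_derivative continuous_on_subset[OF g]) auto
    then show ?thesis using that by (simp add: at_within_Icc_at)
  qed
  have lim: "((\<lambda>\<epsilon>. (G (T + \<epsilon>) - G T) / \<epsilon> - (G (0 + \<epsilon>) - G 0) / \<epsilon>) \<longlongrightarrow> g T - g 0) (at_right 0)"
    using G[of T] G[of 0] T
    by (intro tendsto_diff) (auto simp: DERIV_def intro: tendsto_mono[OF at_le])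
  have "eventually (\<lambda>\<epsilon>. (G (T + \<epsilon>) - G T) / \<epsilon> - (G (0 + \<epsilon>) - G 0) / \<epsilon>
      = integral {0..T} (\<lambda>s. (g (s + \<epsilon>) - g s) / \<epsilon>)) (at_right (0::real))"
    using eventually_at_right_less
  proof eventually_elim
    fix \<epsilon> :: real assume e: "0 < \<epsilon>"
    have "((\<lambda>s. (g (s + \<epsilon>) - g s) / \<epsilon>) has_integral
       ((G (T + \<epsilon>) - G T) / \<epsilon> - (G (0 + \<epsilon>) - G 0) / \<epsilon>)) {0..T}"
    proof (rule has_integral_eq_rhs[OF fundamental_theorem_of_calculus[OF T]])
      show "((\<lambda>s. (G (s + \<epsilon>) - G s) / \<epsilon>) has_vector_derivative (g (s + \<epsilon>) - g s) / \<epsilon>)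
        (at s within {0..T})" if "s \<in> {0..T}" for s
        unfolding has_real_derivative_iff_has_vector_derivative[symmetric]
        using that e by (auto intro!: derivative_eq_intros DERIV_subset[OF DERIV_chain2[OF G]] DERIV_subset[OF G])
    qed (simp add: diff_divide_distrib)
    then show "(G (T + \<epsilon>) - G T) / \<epsilon> - (G (0 + \<epsilon>) - G 0) / \<epsilon>
      = integral {0..T} (\<lambda>s. (g (s + \<epsilon>) - g s) / \<epsilon>)" by (rule integral_unique[symmetric])
  qed
  with lim show ?thesis by (rule Lim_transform_eventually)
qed

text \<open>Lagrange's form of the remainder and the uniform continuity of \<open>f''\<close>.\<close>

lemma second_order_taylor_uniform:
  fixes f f' f'' :: "real \<Rightarrow> real"
  assumes f: "\<And>x. x \<in> {m..M} \<Longrightarrow> (f has_real_derivative f' x) (at x)"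
    and f': "\<And>x. x \<in> {m..M} \<Longrightarrow> (f' has_real_derivative f'' x) (at x)"
    and f'': "continuous_on {m..M} f''" and e: "0 < e"
  obtains d where "0 < d"
    "\<And>x y. x \<in> {m..M} \<Longrightarrow> y \<in> {m..M} \<Longrightarrow> \<bar>y - x\<bar> < d \<Longrightarrow>
      \<bar>f y - f x - f' x * (y - x) - f'' x / 2 * (y - x)\<^sup>2\<bar> \<le> e * (y - x)\<^sup>2"
proof -
  have "uniformly_continuous_on {m..M} f''"
    using f'' by (intro compact_uniformly_continuous) auto
  then obtain d where d: "0 < d"
    and dy: "\<And>x y. x \<in> {m..M} \<Longrightarrow> y \<in> {m..M} \<Longrightarrow> dist y x < d \<Longrightarrow> dist (f'' y) (f'' x) < e"
    using e unfolding uniformly_continuous_on_def by metis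
  show ?thesis
  proof (rule that[OF d])
    fix x y assume xy: "x \<in> {m..M}" "y \<in> {m..M}" "\<bar>y - x\<bar> < d"
    show "\<bar>f y - f x - f' x * (y - x) - f'' x / 2 * (y - x)\<^sup>2\<bar> \<le> e * (y - x)\<^sup>2"
    proof (cases "y = x")
      case False
      define diff where "diff k = (if k = 0 then f else if k = 1 then f' else f'')" for k :: nat
      obtain t where t: "if y < x then y < t \<and> t < x else x < t \<and> t < y"
        and eq: "f y = (\<Sum>k<2. (diff k x / fact k) * (y - x)^k) + (diff 2 t / fact 2) * (y - x)^2"
      proof -
        have "\<forall>k t. k < 2 \<and> m \<le> t \<and> t \<le> M \<longrightarrow> (diff k has_real_derivative diff (Suc k) t) (at t)"
          using f f' by (auto simp: diff_def less_2_cases_iff)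
        from Taylor[OF _ _ this, of f x y] that show ?thesis
          using xy False by (auto simp: diff_def)
      qed
      have "dist (f'' t) (f'' x) < e"
        using t xy by (intro dy) (auto simp: dist_real_def split: if_splits)
      then have "\<bar>(f'' t - f'' x) / 2\<bar> \<le> e" using e by (simp add: dist_real_def)
      then have "\<bar>(f'' t - f'' x) / 2 * (y - x)\<^sup>2\<bar> \<le> e * (y - x)\<^sup>2"
        unfolding abs_mult by (intro mult_mono) auto
      moreover have "f y - f x - f' x * (y - x) - f'' x / 2 * (y - x)\<^sup>2
          = (f'' t - f'' x) / 2 * (y - x)\<^sup>2"
        unfolding eq by (simp add: diff_def numeral_2_eq_2 algebra_simps diff_divide_distrib)
      ultimately show ?thesis by simp
    qed simp
  qed
qed

lemma stopped_increment_tendsto_uniform: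
  fixes x :: "real \<Rightarrow> real"
  assumes T: "0 \<le> T" and x: "continuous_on {0..T} x"
    and eps: "\<And>n. 0 < \<epsilon> n" "\<epsilon> \<longlonglongrightarrow> 0" and d: "0 < d"
  shows "eventually (\<lambda>n. \<forall>s\<in>{0..T}. \<bar>x (min (s + \<epsilon> n) T) - x s\<bar> < d) sequentially"
proof -
  have "uniformly_continuous_on {0..T} x"
    using x by (intro compact_uniformly_continuous) auto
  then obtain r where r: "0 < r"
    and rx: "\<And>s u. s \<in> {0..T} \<Longrightarrow> u \<in> {0..T} \<Longrightarrow> dist u s < r \<Longrightarrow> dist (x u) (x s) < d"
    using d unfolding uniformly_continuous_on_def by metis
  have "eventually (\<lambda>n. \<epsilon> n < r) sequentially" using eps(2) r by (rule order_tendstoD)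
  then show ?thesis
  proof eventually_elim
    case (elim n)
    show ?case
    proof
      fix s assume s: "s \<in> {0..T}"
      have "dist (x (min (s + \<epsilon> n) T)) (x s) < d"
        using s elim eps(1)[of n] by (intro rx) (auto simp: dist_real_def)
      then show "\<bar>x (min (s + \<epsilon> n) T) - x s\<bar> < d" by (simp add: dist_real_def)
    qed
  qed
qed

lemma continuous_on_stopped_shift:
  fixes x :: "real \<Rightarrow> real"
  assumes "continuous_on {0..T} x" "0 \<le> e"
  shows "continuous_on {0..T} (\<lambda>s. x (min (s + e) T))"
  by (rule continuous_on_compose2[OF assms(1)]) (use assms(2) in \<open>auto intro!: continuous_intros\<close>)

text \<open>Ito's formula in the manner of Foellmer and of Russo and Vallois, for one fixed path. Taylor's
  formula writes \<open>f' (x s)\<close> times the increment of \<open>x\<close> as the increment of \<open>f \<circ> x\<close>, minus half of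
  \<open>f'' (x s)\<close> times the squared increment, minus a remainder. Divided by \<open>\<epsilon> n\<close> and integrated, the
  first term tends to the increment of \<open>f \<circ> x\<close> over \<open>[0, T]\<close>, the second converges by the hypothesis
  on the quadratic variation, and the third is at most an arbitrarily small multiple of the
  quadratic variation.\<close>

lemma pathwise_ito:
  fixes x f f' f'' :: "real \<Rightarrow> real" and \<epsilon> :: "nat \<Rightarrow> real"
  assumes T: "0 \<le> T" and x: "continuous_on {0..T} x"
    and range: "x ` {0..T} \<subseteq> {m..M}"
    and f: "\<And>z. z \<in> {m..M} \<Longrightarrow> (f has_real_derivative f' z) (at z)"
    and f': "\<And>z. z \<in> {m..M} \<Longrightarrow> (f' has_real_derivative f'' z) (at z)"
    and f'': "continuous_on {m..M} f''"
    and eps: "\<And>n. 0 < \<epsilon> n" "\<epsilon> \<longlonglongrightarrow> 0"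
    and qv: "\<And>y. continuous_on {0..T} y \<Longrightarrow>
      (\<lambda>n. integral {0..T} (\<lambda>s. y s * ((x (min (s + \<epsilon> n) T) - x s)\<^sup>2 / \<epsilon> n)))
        \<longlonglongrightarrow> c * integral {0..T} y"
  shows "(\<lambda>n. integral {0..T} (\<lambda>s. f' (x s) * ((x (min (s + \<epsilon> n) T) - x s) / \<epsilon> n)))
    \<longlonglongrightarrow> f (x T) - f (x 0) - c / 2 * integral {0..T} (\<lambda>s. f'' (x s))"
proof -
  define D where "D n s = x (min (s + \<epsilon> n) T) - x s" for n s
  have D: "continuous_on {0..T} (D n)" for n
    unfolding D_def using x eps(1)[of n]
    by (intro continuous_intros continuous_on_stopped_shift) auto
  have fc: "continuous_on {m..M} f" "continuous_on {m..M} f'"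
    using f f' by (blast intro: DERIV_continuous_on DERIV_subset)+
  have fx: "continuous_on {0..T} (\<lambda>s. f (x s))" "continuous_on {0..T} (\<lambda>s. f' (x s))"
    "continuous_on {0..T} (\<lambda>s. f'' (x s))"
    using range by (auto intro: continuous_on_compose2[OF fc(1) x]
      continuous_on_compose2[OF fc(2) x] continuous_on_compose2[OF f'' x])
  define h where "h n s = (f (x (min (s + \<epsilon> n) T)) - f (x s)) / \<epsilon> n" for n s
  define R where "R n s = h n s - f' (x s) * (D n s / \<epsilon> n) - f'' (x s) / 2 * ((D n s)\<^sup>2 / \<epsilon> n)" for n s
  have h: "continuous_on {0..T} (h n)" for n
    unfolding h_def using eps(1)[of n]
    by (intro continuous_intros continuous_on_stopped_shift[OF fx(1)] fx) auto
  have R: "continuous_on {0..T} (R n)" for n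
    unfolding R_def using eps(1)[of n] by (intro continuous_intros h D fx) auto
  \<comment> \<open>Here \<open>f \<circ> x\<close> is extended to the line by its values at \<open>0\<close> and \<open>T\<close>.\<close>
  have lim_h: "(\<lambda>n. integral {0..T} (h n)) \<longlonglongrightarrow> f (x T) - f (x 0)"
  proof -
    define g where "g s = f (x (max 0 (min s T)))" for s
    have "continuous_on UNIV g"
      unfolding g_def
      by (rule continuous_on_compose2[OF fx(1)]) (use T in \<open>auto intro!: continuous_intros\<close>)
    from integral_shift_quotient_tendsto[OF T this]
    have "(\<lambda>n. integral {0..T} (\<lambda>s. (g (s + \<epsilon> n) - g s) / \<epsilon> n)) \<longlonglongrightarrow> g T - g 0"
      by (rule filterlim_compose) (use eps(2) eps(1)[THEN less_imp_neq, THEN not_sym] eps(1) in \<open>auto simp: filterlim_at\<close>)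
    moreover have "integral {0..T} (\<lambda>s. (g (s + \<epsilon> n) - g s) / \<epsilon> n) = integral {0..T} (h n)" for n
      using eps(1)[of n] T
      by (intro Henstock_Kurzweil_Integration.integral_cong) (auto simp: g_def h_def min_def max_def)
    ultimately show ?thesis using T by (simp add: g_def)
  qed
  have lim_qv: "(\<lambda>n. integral {0..T} (\<lambda>s. f'' (x s) / 2 * ((D n s)\<^sup>2 / \<epsilon> n)))
      \<longlonglongrightarrow> c * integral {0..T} (\<lambda>s. f'' (x s) / 2)"
    unfolding D_def using fx by (intro qv continuous_intros) auto
  have lim_1: "(\<lambda>n. integral {0..T} (\<lambda>s. (D n s)\<^sup>2 / \<epsilon> n)) \<longlonglongrightarrow> c * T"
    unfolding D_def using qv[of "\<lambda>s. 1"] T by simp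
  have lim_R: "(\<lambda>n. integral {0..T} (R n)) \<longlonglongrightarrow> 0"
  proof (rule tendstoI)
    fix r :: real assume r: "0 < r"
    define e where "e = r / (\<bar>c * T\<bar> + 1)"
    have e: "0 < e" using r by (simp add: e_def)
    obtain d where d: "0 < d" and dT: "\<And>z y. z \<in> {m..M} \<Longrightarrow> y \<in> {m..M} \<Longrightarrow> \<bar>y - z\<bar> < d \<Longrightarrow>
        \<bar>f y - f z - f' z * (y - z) - f'' z / 2 * (y - z)\<^sup>2\<bar> \<le> e * (y - z)\<^sup>2"
      using second_order_taylor_uniform[OF f f' f'' e] by metis
    have "eventually (\<lambda>n. \<forall>s\<in>{0..T}. \<bar>x (min (s + \<epsilon> n) T) - x s\<bar> < d) sequentially"
      by (rule stopped_increment_tendsto_uniform[OF T x eps d])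
    moreover have "eventually (\<lambda>n. dist (integral {0..T} (\<lambda>s. (D n s)\<^sup>2 / \<epsilon> n)) (c * T) < 1) sequentially"
      using lim_1 by (rule tendstoD) simp
    ultimately show "eventually (\<lambda>n. dist (integral {0..T} (R n)) 0 < r) sequentially"
    proof eventually_elim
      case (elim n)
      have "norm (integral {0..T} (R n)) \<le> integral {0..T} (\<lambda>s. e * ((D n s)\<^sup>2 / \<epsilon> n))"
      proof (rule integral_norm_bound_integral)
        show "R n integrable_on {0..T}" using R by (rule integrable_continuous_interval)
        show "(\<lambda>s. e * ((D n s)\<^sup>2 / \<epsilon> n)) integrable_on {0..T}"
          using D eps(1)[of n] by (intro integrable_continuous_interval continuous_intros) auto
        fix s assume s: "s \<in> {0..T}"
        then have s': "min (s + \<epsilon> n) T \<in> {0..T}" using eps(1)[of n] by auto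
        have "\<bar>f (x (min (s + \<epsilon> n) T)) - f (x s) - f' (x s) * D n s - f'' (x s) / 2 * (D n s)\<^sup>2\<bar>
            \<le> e * (D n s)\<^sup>2"
          unfolding D_def using s s' range elim by (intro dT) blast+
        moreover have "R n s = (f (x (min (s + \<epsilon> n) T)) - f (x s) - f' (x s) * D n s
            - f'' (x s) / 2 * (D n s)\<^sup>2) / \<epsilon> n"
          using eps(1)[of n] by (simp add: R_def h_def field_simps)
        ultimately show "norm (R n s) \<le> e * ((D n s)\<^sup>2 / \<epsilon> n)"
          using eps(1)[of n] by (simp add: divide_right_mono)
      qed
      also have "\<dots> = e * integral {0..T} (\<lambda>s. (D n s)\<^sup>2 / \<epsilon> n)" by simp
      also have "\<dots> < e * (\<bar>c * T\<bar> + 1)"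
        using elim e by (intro mult_strict_left_mono) (auto simp: dist_real_def)
      also have "\<dots> = r" by (simp add: e_def)
      finally show ?case by (simp add: dist_real_def)
    qed
  qed
  have "integral {0..T} (\<lambda>s. f' (x s) * (D n s / \<epsilon> n)) = integral {0..T} (h n)
      - integral {0..T} (\<lambda>s. f'' (x s) / 2 * ((D n s)\<^sup>2 / \<epsilon> n)) - integral {0..T} (R n)" for n
  proof -
    have "integral {0..T} (\<lambda>s. f' (x s) * (D n s / \<epsilon> n))
        = integral {0..T} (\<lambda>s. h n s - f'' (x s) / 2 * ((D n s)\<^sup>2 / \<epsilon> n) - R n s)"
      by (intro Henstock_Kurzweil_Integration.integral_cong) (simp add: R_def)
    also have "\<dots> = integral {0..T} (\<lambda>s. h n s - f'' (x s) / 2 * ((D n s)\<^sup>2 / \<epsilon> n))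
        - integral {0..T} (R n)"
      using eps(1)[of n] by (intro Henstock_Kurzweil_Integration.integral_diff
        integrable_continuous_interval continuous_intros h R D fx) auto
    also have "integral {0..T} (\<lambda>s. h n s - f'' (x s) / 2 * ((D n s)\<^sup>2 / \<epsilon> n))
        = integral {0..T} (h n) - integral {0..T} (\<lambda>s. f'' (x s) / 2 * ((D n s)\<^sup>2 / \<epsilon> n))"
      using eps(1)[of n] by (intro Henstock_Kurzweil_Integration.integral_diff
        integrable_continuous_interval continuous_intros h R D fx) auto
    finally show ?thesis .
  qed
  then have "(\<lambda>n. integral {0..T} (\<lambda>s. f' (x s) * (D n s / \<epsilon> n)))
    \<longlonglongrightarrow> f (x T) - f (x 0) - c * integral {0..T} (\<lambda>s. f'' (x s) / 2) - 0"
    by (simp only: ) (intro tendsto_diff lim_h lim_qv lim_R)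
  then show ?thesis by (simp add: D_def)
qed

lemma stopped_clock_quotient_tendsto:
  fixes \<epsilon> :: "nat \<Rightarrow> real"
  assumes u: "0 \<le> u" "u \<le> T" and eps: "\<And>n. 0 < \<epsilon> n" "\<epsilon> \<longlonglongrightarrow> 0"
  shows "(\<lambda>n. integral {0..u} (\<lambda>s. (min (s + \<epsilon> n) T - s) / \<epsilon> n)) \<longlonglongrightarrow> u"
proof -
  have "((\<lambda>\<epsilon>. integral {0..u} (\<lambda>s. (min (s + \<epsilon>) T - min s T) / \<epsilon>))
      \<longlongrightarrow> min u T - min 0 T) (at_right 0)"
    using u by (intro integral_shift_quotient_tendsto continuous_intros)
  then have "(\<lambda>n. integral {0..u} (\<lambda>s. (min (s + \<epsilon> n) T - min s T) / \<epsilon> n))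
      \<longlonglongrightarrow> min u T - min 0 T"
    by (rule filterlim_compose)
      (use eps(2) eps(1)[THEN less_imp_neq, THEN not_sym] eps(1) in \<open>auto simp: filterlim_at\<close>)
  moreover have "integral {0..u} (\<lambda>s. (min (s + \<epsilon> n) T - min s T) / \<epsilon> n)
      = integral {0..u} (\<lambda>s. (min (s + \<epsilon> n) T - s) / \<epsilon> n)" for n
    using u by (intro Henstock_Kurzweil_Integration.integral_cong) auto
  ultimately show ?thesis
    using u by (simp only:) simp
qed

text \<open>The step \<open>min (s + \<epsilon> n) T - s\<close> is \<open>\<epsilon> n\<close> except on the last interval of length \<open>\<epsilon> n\<close>, so that a
  drift contributes its ordinary integral in the limit.\<close>

lemma stopped_clock_weighted_tendsto:
  fixes y :: "real \<Rightarrow> real" and \<epsilon> :: "nat \<Rightarrow> real"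
  assumes T: "0 \<le> T" and y: "continuous_on {0..T} y"
    and eps: "\<And>n. 0 < \<epsilon> n" "\<epsilon> \<longlonglongrightarrow> 0"
  shows "(\<lambda>n. integral {0..T} (\<lambda>s. y s * ((min (s + \<epsilon> n) T - s) / \<epsilon> n)))
    \<longlonglongrightarrow> integral {0..T} y"
proof (rule weighted_integral_tendsto[OF T y])
  show "continuous_on {0..T} (\<lambda>s. (min (s + \<epsilon> n) T - s) / \<epsilon> n)" for n
    using eps(1)[of n] by (intro continuous_intros) auto
  show "0 \<le> (min (s + \<epsilon> n) T - s) / \<epsilon> n" if "s \<in> {0..T}" for n s
    using that eps(1)[of n] by auto
  show "(\<lambda>n. integral {0..real k * T / real N} (\<lambda>s. (min (s + \<epsilon> n) T - s) / \<epsilon> n))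
      \<longlonglongrightarrow> real k * T / real N" if "0 < N" "k \<le> N" for k N :: nat
    using T that mult_right_mono[of "real k" "real N" T]
    by (intro stopped_clock_quotient_tendsto eps) (auto simp: field_simps)
qed

lemma integral_tendsto_zero_uniform:
  fixes R :: "nat \<Rightarrow> real \<Rightarrow> real"
  assumes T: "0 \<le> T" and R: "\<And>n. continuous_on {0..T} (R n)"
    and small: "\<And>r. 0 < r \<Longrightarrow> eventually (\<lambda>n. \<forall>s\<in>{0..T}. \<bar>R n s\<bar> \<le> r) sequentially"
  shows "(\<lambda>n. integral {0..T} (R n)) \<longlonglongrightarrow> 0"
proof (rule tendstoI)
  fix r :: real assume r: "0 < r"
  define e where "e = r / (T + 1)"
  have e: "0 < e" using r T by (simp add: e_def)
  show "eventually (\<lambda>n. dist (integral {0..T} (R n)) 0 < r) sequentially"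
    using small[OF e]
  proof eventually_elim
    case (elim n)
    have "norm (integral {0..T} (R n)) \<le> integral {0..T} (\<lambda>s. e)"
      using elim R by (intro integral_norm_bound_integral integrable_continuous_interval) auto
    also have "\<dots> < r" using T r by (auto simp: e_def field_simps)
    finally show ?case by simp
  qed
qed

text \<open>A drift does not contribute to the quadratic variation: the additional terms carry a factor
  \<open>(min (s + \<epsilon> n) T - s) / \<epsilon> n\<close>, which is at most \<open>1\<close>, times an increment of time or of \<open>w\<close>, which
  vanishes uniformly.\<close>

lemma affine_path_quadratic_variation:
  fixes w :: "real \<Rightarrow> real" and \<epsilon> :: "nat \<Rightarrow> real" and x0 a b :: real
  assumes T: "0 \<le> T" and w: "continuous_on {0..T} w"
    and eps: "\<And>n. 0 < \<epsilon> n" "\<epsilon> \<longlonglongrightarrow> 0"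
    and qv: "\<And>y. continuous_on {0..T} y \<Longrightarrow>
      (\<lambda>n. integral {0..T} (\<lambda>s. y s * ((w (min (s + \<epsilon> n) T) - w s)\<^sup>2 / \<epsilon> n)))
        \<longlonglongrightarrow> integral {0..T} y"
    and y: "continuous_on {0..T} y"
  defines "x \<equiv> \<lambda>s. x0 - a * s - b * w s"
  shows "(\<lambda>n. integral {0..T} (\<lambda>s. y s * ((x (min (s + \<epsilon> n) T) - x s)\<^sup>2 / \<epsilon> n)))
    \<longlonglongrightarrow> b\<^sup>2 * integral {0..T} y"
proof -
  define D where "D n s = w (min (s + \<epsilon> n) T) - w s" for n s
  define C where "C n s = min (s + \<epsilon> n) T - s" for n s
  have D: "continuous_on {0..T} (D n)" for n
    unfolding D_def using w eps(1)[of n]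
    by (intro continuous_intros continuous_on_stopped_shift) auto
  have C: "continuous_on {0..T} (C n)" for n
    unfolding C_def by (intro continuous_intros)
  have C_bound: "\<bar>C n s\<bar> \<le> \<epsilon> n" if "s \<in> {0..T}" for n s
    using that eps(1)[of n] by (auto simp: C_def)
  \<comment> \<open>The weighted squared increment of \<open>x\<close> without the contribution of the increment of \<open>w\<close> alone.\<close>
  define R where "R n s = y s * ((a\<^sup>2 * C n s + 2 * a * b * D n s) * (C n s / \<epsilon> n))" for n s
  have R: "continuous_on {0..T} (R n)" for n
    unfolding R_def using eps(1)[of n] by (intro continuous_intros y C D) auto
  obtain B where B: "0 < B" "\<And>s. s \<in> {0..T} \<Longrightarrow> \<bar>y s\<bar> \<le> B"
    using compact_imp_bounded[OF compact_continuous_image[OF y]] unfolding bounded_pos by auto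
  have "(\<lambda>n. integral {0..T} (R n)) \<longlonglongrightarrow> 0"
  proof (rule integral_tendsto_zero_uniform[OF T R])
    fix r :: real assume r: "0 < r"
    define K where "K = a\<^sup>2 + \<bar>2 * a * b\<bar> + 1"
    define d where "d = r / (B * K)"
    have K: "0 < K" by (simp add: K_def add_nonneg_pos)
    then have d: "0 < d" using r B by (simp add: d_def)
    have "eventually (\<lambda>n. \<forall>s\<in>{0..T}. \<bar>w (min (s + \<epsilon> n) T) - w s\<bar> < d) sequentially"
      by (rule stopped_increment_tendsto_uniform[OF T w eps d])
    moreover have "eventually (\<lambda>n. \<epsilon> n < d) sequentially" using eps(2) d by (rule order_tendstoD)
    ultimately show "eventually (\<lambda>n. \<forall>s\<in>{0..T}. \<bar>R n s\<bar> \<le> r) sequentially"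
    proof eventually_elim
      case (elim n)
      show ?case
      proof
        fix s assume s: "s \<in> {0..T}"
        have "\<bar>D n s\<bar> \<le> d" "\<bar>C n s\<bar> \<le> d"
          using elim s C_bound[OF s, of n] by (auto simp: D_def intro: less_imp_le)
        then have "\<bar>a\<^sup>2 * C n s\<bar> \<le> a\<^sup>2 * d" "\<bar>2 * a * b * D n s\<bar> \<le> \<bar>2 * a * b\<bar> * d"
          by (auto simp: abs_mult intro!: mult_left_mono)
        then have "\<bar>a\<^sup>2 * C n s + 2 * a * b * D n s\<bar> \<le> a\<^sup>2 * d + \<bar>2 * a * b\<bar> * d"
          by linarith
        also have "\<dots> \<le> K * d" using d by (simp add: K_def algebra_simps)
        finally have 1: "\<bar>a\<^sup>2 * C n s + 2 * a * b * D n s\<bar> \<le> K * d" .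
        have 2: "\<bar>C n s / \<epsilon> n\<bar> \<le> 1"
          using C_bound[OF s, of n] eps(1)[of n] by (simp add: divide_le_eq_1)
        have "\<bar>R n s\<bar> \<le> B * (K * d * 1)"
          unfolding R_def abs_mult[of "y s"] abs_mult[of _ "C n s / \<epsilon> n"]
          using B s 1 2 K d by (intro mult_mono) auto
        also have "\<dots> = r" using B K by (simp add: d_def)
        finally show "\<bar>R n s\<bar> \<le> r" .
      qed
    qed
  qed
  moreover have "(\<lambda>n. integral {0..T} (\<lambda>s. y s * ((D n s)\<^sup>2 / \<epsilon> n))) \<longlonglongrightarrow> integral {0..T} y"
    unfolding D_def by (rule qv[OF y])
  ultimately have lim: "(\<lambda>n. b\<^sup>2 * integral {0..T} (\<lambda>s. y s * ((D n s)\<^sup>2 / \<epsilon> n)) + integral {0..T} (R n))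
      \<longlonglongrightarrow> b\<^sup>2 * integral {0..T} y + 0"
    by (intro tendsto_intros)
  have "integral {0..T} (\<lambda>s. y s * ((x (min (s + \<epsilon> n) T) - x s)\<^sup>2 / \<epsilon> n))
      = b\<^sup>2 * integral {0..T} (\<lambda>s. y s * ((D n s)\<^sup>2 / \<epsilon> n)) + integral {0..T} (R n)" for n
  proof -
    have dx: "x (min (s + \<epsilon> n) T) - x s = - a * C n s - b * D n s" for s
      by (simp add: x_def C_def D_def algebra_simps)
    have "y s * ((x (min (s + \<epsilon> n) T) - x s)\<^sup>2 / \<epsilon> n)
        = b\<^sup>2 * (y s * ((D n s)\<^sup>2 / \<epsilon> n)) + R n s" for s
      unfolding dx using eps(1)[of n] by (simp add: R_def field_simps power2_eq_square)
    then have "integral {0..T} (\<lambda>s. y s * ((x (min (s + \<epsilon> n) T) - x s)\<^sup>2 / \<epsilon> n))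
      = integral {0..T} (\<lambda>s. b\<^sup>2 * (y s * ((D n s)\<^sup>2 / \<epsilon> n)) + R n s)"
      by (simp only:)
    also have "\<dots> = integral {0..T} (\<lambda>s. b\<^sup>2 * (y s * ((D n s)\<^sup>2 / \<epsilon> n))) + integral {0..T} (R n)"
      using eps(1)[of n] by (intro Henstock_Kurzweil_Integration.integral_add
        integrable_continuous_interval continuous_intros R y D) auto
    finally show ?thesis by simp
  qed
  with lim show ?thesis by simp
qed

text \<open>The lemma \<open>pathwise_ito\<close> for \<open>f z = z powr (1 / (1 - p))\<close>, smooth on the compact range of \<open>X\<close> in the
  open half line. The constants are such that \<open>f' (X s)\<close> times an increment of \<open>X\<close> equals
  \<open>X s powr (p / (1 - p))\<close> times the sum of \<open>c\<^sub>1\<close> times the time step and \<open>c\<^sub>2\<close> times the increment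
  of \<open>w\<close>.\<close>

lemma pathwise_power_ito:
  fixes w :: "real \<Rightarrow> real" and \<epsilon> :: "nat \<Rightarrow> real" and x0 c\<^sub>1 c\<^sub>2 p :: real
  assumes T: "0 \<le> T" and w: "continuous_on {0..T} w" and p: "1 < p" and c2: "0 < c\<^sub>2"
    and eps: "\<And>n. 0 < \<epsilon> n" "\<epsilon> \<longlonglongrightarrow> 0"
    and qv: "\<And>y. continuous_on {0..T} y \<Longrightarrow>
      (\<lambda>n. integral {0..T} (\<lambda>s. y s * ((w (min (s + \<epsilon> n) T) - w s)\<^sup>2 / \<epsilon> n)))
        \<longlonglongrightarrow> integral {0..T} y"
  defines "X \<equiv> \<lambda>s. x0 - c\<^sub>1 * (p - 1) * s - c\<^sub>2 * (p - 1) * w s"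
  assumes pos: "\<And>s. s \<in> {0..T} \<Longrightarrow> 0 < X s"
  shows "(\<lambda>n. integral {0..T} (\<lambda>s. X s powr (p / (1 - p)) * ((w (min (s + \<epsilon> n) T) - w s) / \<epsilon> n)))
    \<longlonglongrightarrow> (X T powr (1 / (1 - p)) - X 0 powr (1 / (1 - p))
        - integral {0..T} (\<lambda>s. c\<^sub>1 * X s powr (p / (1 - p))
            + p * c\<^sub>2\<^sup>2 / 2 * X s powr ((2 * p - 1) / (1 - p)))) / c\<^sub>2"
proof -
  define a b where "a = c\<^sub>1 * (p - 1)" and "b = c\<^sub>2 * (p - 1)"
  have X_ab: "X = (\<lambda>s. x0 - a * s - b * w s)" by (simp add: X_def a_def b_def)
  have b: "0 < b" using p c2 by (simp add: b_def)
  have X: "continuous_on {0..T} X" unfolding X_ab by (intro continuous_intros w)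
  have "0 \<in> {0..T}" using T by simp
  then have ne: "{0..T} \<noteq> {}" by blast
  obtain s0 where s0: "s0 \<in> {0..T}" "\<And>s. s \<in> {0..T} \<Longrightarrow> X s0 \<le> X s"
    using continuous_attains_inf[OF compact_Icc ne X] by blast
  obtain s1 where s1: "s1 \<in> {0..T}" "\<And>s. s \<in> {0..T} \<Longrightarrow> X s \<le> X s1"
    using continuous_attains_sup[OF compact_Icc ne X] by blast
  define f f' f'' where "f z = z powr (1 / (1 - p))"
    and "f' z = 1 / (1 - p) * z powr (p / (1 - p))"
    and "f'' z = p / (p - 1)\<^sup>2 * z powr ((2 * p - 1) / (1 - p))" for z :: real
  have e1: "1 / (1 - p) - 1 = p / (1 - p)" and e2: "p / (1 - p) - 1 = (2 * p - 1) / (1 - p)"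
    using p by (auto simp: field_simps)
  have K_pos: "0 < z" if "z \<in> {X s0..X s1}" for z using that pos[OF s0(1)] by auto
  have f: "(f has_real_derivative f' z) (at z)" if "z \<in> {X s0..X s1}" for z
    unfolding f_def f'_def using has_real_derivative_powr[OF K_pos[OF that], of "1 / (1 - p)"]
    unfolding e1 by simp
  have f': "(f' has_real_derivative f'' z) (at z)" if "z \<in> {X s0..X s1}" for z
  proof -
    have "(f' has_real_derivative 1 / (1 - p) * (p / (1 - p) * z powr (p / (1 - p) - 1))) (at z)"
      unfolding f'_def
      using has_real_derivative_powr[OF K_pos[OF that], of "p / (1 - p)"] by (rule DERIV_cmult)
    moreover have "1 / (1 - p) * (p / (1 - p)) = p / (p - 1)\<^sup>2"
    proof -
      have "(1 - p) * (1 - p) = (p - 1)\<^sup>2" by (simp add: power2_eq_square algebra_simps)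
      then show ?thesis by simp
    qed
    ultimately show ?thesis unfolding f''_def e2 mult.assoc[symmetric] by (simp only:)
  qed
  have f'': "continuous_on {X s0..X s1} f''"
    unfolding f''_def using K_pos by (intro continuous_intros) force+
  have cont: "continuous_on {0..T} (\<lambda>s. X s powr r)" for r
    using pos by (intro continuous_intros X) force+
  have fx: "continuous_on {0..T} (\<lambda>s. f' (X s))" "continuous_on {0..T} (\<lambda>s. f'' (X s))"
    unfolding f'_def f''_def by (intro continuous_intros cont)+
  define D where "D n s = w (min (s + \<epsilon> n) T) - w s" for n s
  have D: "continuous_on {0..T} (D n)" for n
    unfolding D_def using w eps(1)[of n]
    by (intro continuous_intros continuous_on_stopped_shift) auto
  have DX: "continuous_on {0..T} (\<lambda>s. X (min (s + \<epsilon> n) T) - X s)" for n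
    using X eps(1)[of n] by (intro continuous_intros continuous_on_stopped_shift) auto
  have lim_X: "(\<lambda>n. integral {0..T} (\<lambda>s. f' (X s) * ((X (min (s + \<epsilon> n) T) - X s) / \<epsilon> n)))
    \<longlonglongrightarrow> f (X T) - f (X 0) - b\<^sup>2 / 2 * integral {0..T} (\<lambda>s. f'' (X s))"
  proof (rule pathwise_ito[OF T X _ f f' f'' eps])
    show "X ` {0..T} \<subseteq> {X s0..X s1}" using s0 s1 by auto
    show "(\<lambda>n. integral {0..T} (\<lambda>s. y s * ((X (min (s + \<epsilon> n) T) - X s)\<^sup>2 / \<epsilon> n)))
        \<longlonglongrightarrow> b\<^sup>2 * integral {0..T} y" if "continuous_on {0..T} y" for y
      unfolding X_ab by (rule affine_path_quadratic_variation[OF T w eps qv that])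
  qed
  have lim_t: "(\<lambda>n. integral {0..T} (\<lambda>s. f' (X s) * ((min (s + \<epsilon> n) T - s) / \<epsilon> n)))
    \<longlonglongrightarrow> integral {0..T} (\<lambda>s. f' (X s))"
    by (rule stopped_clock_weighted_tendsto[OF T fx(1) eps])
  have split: "integral {0..T} (\<lambda>s. X s powr (p / (1 - p)) * (D n s / \<epsilon> n))
      = (integral {0..T} (\<lambda>s. f' (X s) * ((X (min (s + \<epsilon> n) T) - X s) / \<epsilon> n))
         + a * integral {0..T} (\<lambda>s. f' (X s) * ((min (s + \<epsilon> n) T - s) / \<epsilon> n))) / c\<^sub>2" for n
  proof -
    have "X s powr (p / (1 - p)) * (D n s / \<epsilon> n)
        = (f' (X s) * ((X (min (s + \<epsilon> n) T) - X s) / \<epsilon> n)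
          + a * (f' (X s) * ((min (s + \<epsilon> n) T - s) / \<epsilon> n))) / c\<^sub>2" for s
    proof -
      have "f' (X s) * ((X (min (s + \<epsilon> n) T) - X s) / \<epsilon> n)
          + a * (f' (X s) * ((min (s + \<epsilon> n) T - s) / \<epsilon> n)) = - b * f' (X s) * (D n s / \<epsilon> n)"
        using eps(1)[of n] by (simp add: X_ab D_def field_simps)
      also have "- b * f' (X s) = c\<^sub>2 * X s powr (p / (1 - p))"
        using p by (simp add: b_def f'_def field_simps)
      finally show ?thesis using c2 by simp
    qed
    then have "integral {0..T} (\<lambda>s. X s powr (p / (1 - p)) * (D n s / \<epsilon> n))
        = integral {0..T} (\<lambda>s. f' (X s) * ((X (min (s + \<epsilon> n) T) - X s) / \<epsilon> n)
          + a * (f' (X s) * ((min (s + \<epsilon> n) T - s) / \<epsilon> n))) / c\<^sub>2"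
      by (simp only: integral_divide)
    also have "integral {0..T} (\<lambda>s. f' (X s) * ((X (min (s + \<epsilon> n) T) - X s) / \<epsilon> n)
          + a * (f' (X s) * ((min (s + \<epsilon> n) T - s) / \<epsilon> n)))
        = integral {0..T} (\<lambda>s. f' (X s) * ((X (min (s + \<epsilon> n) T) - X s) / \<epsilon> n))
          + integral {0..T} (\<lambda>s. a * (f' (X s) * ((min (s + \<epsilon> n) T - s) / \<epsilon> n)))"
      using eps(1)[of n] by (intro Henstock_Kurzweil_Integration.integral_add
        integrable_continuous_interval continuous_intros fx DX) auto
    finally show ?thesis by simp
  qed
  have "(\<lambda>n. integral {0..T} (\<lambda>s. X s powr (p / (1 - p)) * (D n s / \<epsilon> n)))
    \<longlonglongrightarrow> (f (X T) - f (X 0) - b\<^sup>2 / 2 * integral {0..T} (\<lambda>s. f'' (X s))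
       + a * integral {0..T} (\<lambda>s. f' (X s))) / c\<^sub>2" (is "?A \<longlonglongrightarrow> (?F - ?G - ?H + ?K) / c\<^sub>2")
    unfolding split by (intro tendsto_intros lim_X lim_t) (use c2 in simp)
  moreover have "?F - ?G - ?H + ?K = ?F - ?G - (?H - ?K)" by simp
  moreover have "b\<^sup>2 / 2 * integral {0..T} (\<lambda>s. f'' (X s)) - a * integral {0..T} (\<lambda>s. f' (X s))
      = integral {0..T} (\<lambda>s. c\<^sub>1 * X s powr (p / (1 - p))
            + p * c\<^sub>2\<^sup>2 / 2 * X s powr ((2 * p - 1) / (1 - p)))"
  proof -
    have "integral {0..T} (\<lambda>s. c\<^sub>1 * X s powr (p / (1 - p))
            + p * c\<^sub>2\<^sup>2 / 2 * X s powr ((2 * p - 1) / (1 - p)))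
        = integral {0..T} (\<lambda>s. b\<^sup>2 / 2 * f'' (X s) - a * f' (X s))"
    proof -
      have 1: "a * (1 / (1 - p)) = - c\<^sub>1" using p by (simp add: a_def field_simps)
      have 2: "b\<^sup>2 / 2 * (p / (p - 1)\<^sup>2) = p * c\<^sub>2\<^sup>2 / 2"
        using p by (simp add: b_def power_mult_distrib)
      have "b\<^sup>2 / 2 * f'' z - a * f' z
          = c\<^sub>1 * z powr (p / (1 - p)) + p * c\<^sub>2\<^sup>2 / 2 * z powr ((2 * p - 1) / (1 - p))" for z
        unfolding f'_def f''_def mult.assoc[symmetric] 1 2 by simp
      then show ?thesis by simp
    qed
    also have "\<dots> = integral {0..T} (\<lambda>s. b\<^sup>2 / 2 * f'' (X s)) - integral {0..T} (\<lambda>s. a * f' (X s))"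
      by (intro Henstock_Kurzweil_Integration.integral_diff
        integrable_continuous_interval continuous_intros fx)
    finally show ?thesis by simp
  qed
  ultimately show ?thesis
    unfolding D_def f_def by (simp only:)
qed

section \<open>Quadratic variation from the moments of the increments\<close>

text \<open>Paths may be changed on a null set without loss of measurability.\<close>

lemma (in complete_measure) borel_measurable_AE_eq:
  fixes f g :: "'a \<Rightarrow> real"
  assumes f: "f \<in> borel_measurable M" and eq: "AE \<omega> in M. f \<omega> = g \<omega>"
  shows "g \<in> borel_measurable M"
proof (rule measurableI)
  fix A :: "real set" assume A: "A \<in> sets borel"
  show "g -` A \<inter> space M \<in> sets M"
  proof (rule in_sets_AE)
    show "AE \<omega> in M. \<omega> \<in> f -` A \<inter> space M \<longleftrightarrow> \<omega> \<in> g -` A \<inter> space M"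
      using eq by eventually_elim auto
  qed (use measurable_sets[OF f A] in auto)
qed simp

text \<open>The process is the pointwise limit of its values at \<open>\<lfloor>(n + 1) s\<rfloor> / (n + 1)\<close>, which depend on time
  through a countable set only.\<close>

lemma borel_measurable_continuous_process:
  fixes V :: "real \<Rightarrow> 'a \<Rightarrow> real"
  assumes V[measurable]: "\<And>s. V s \<in> borel_measurable M"
    and cont: "\<And>\<omega>. \<omega> \<in> space M \<Longrightarrow> continuous_on UNIV (\<lambda>s. V s \<omega>)"
  shows "(\<lambda>(s, \<omega>). V s \<omega>) \<in> borel_measurable (borel \<Otimes>\<^sub>M M)"
proof -
  \<comment> \<open>The largest multiple of \<open>1 / (n + 1)\<close> that does not exceed \<open>s\<close>.\<close>
  define r where "r n s = real_of_int \<lfloor>real (Suc n) * s\<rfloor> / real (Suc n)" for n s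
  have r: "(\<lambda>n. r n s) \<longlonglongrightarrow> s" for s
  proof (rule tendsto_sandwich)
    show "(\<lambda>n. s - 1 / real (Suc n)) \<longlonglongrightarrow> s"
      by (rule tendsto_eq_intros LIMSEQ_Suc[OF lim_1_over_n] refl | simp)+
    show "eventually (\<lambda>n. s - 1 / real (Suc n) \<le> r n s) sequentially"
    proof (intro always_eventually allI)
      fix n
      have "real (Suc n) * s - 1 \<le> real_of_int \<lfloor>real (Suc n) * s\<rfloor>" by linarith
      then have "(real (Suc n) * s - 1) / real (Suc n) \<le> r n s"
        unfolding r_def by (rule divide_right_mono) simp
      moreover have "(real (Suc n) * s - 1) / real (Suc n) = s - 1 / real (Suc n)"
        by (simp add: diff_divide_distrib del: of_nat_Suc)
      ultimately show "s - 1 / real (Suc n) \<le> r n s" by simp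
    qed
    show "eventually (\<lambda>n. r n s \<le> s) sequentially"
    proof (intro always_eventually allI)
      fix n
      have "real_of_int \<lfloor>real (Suc n) * s\<rfloor> \<le> real (Suc n) * s" by linarith
      then have "r n s \<le> real (Suc n) * s / real (Suc n)"
        unfolding r_def by (rule divide_right_mono) simp
      then show "r n s \<le> s" by (simp del: of_nat_Suc)
    qed
  qed simp
  show ?thesis
  proof (rule borel_measurable_LIMSEQ_real)
    fix n
    have "(\<lambda>z. (\<lambda>(i::int) z. V (real_of_int i / real (Suc n)) (snd z)) \<lfloor>real (Suc n) * fst z\<rfloor> z)
        \<in> borel_measurable (borel \<Otimes>\<^sub>M M)"
      by (rule measurable_compose_countable) measurable
    then show "(\<lambda>(s, \<omega>). V (r n s) \<omega>) \<in> borel_measurable (borel \<Otimes>\<^sub>M M)"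
      by (simp add: r_def split_beta')
  next
    fix z :: "real \<times> 'a" assume z: "z \<in> space (borel \<Otimes>\<^sub>M M)"
    obtain s \<omega> where z_eq: "z = (s, \<omega>)" and \<omega>: "\<omega> \<in> space M"
      using z by (auto simp: space_pair_measure)
    have "(\<lambda>n. V (r n s) \<omega>) \<longlonglongrightarrow> V s \<omega>"
      by (rule continuous_on_tendsto_compose[OF cont[OF \<omega>] r]) auto
    then show "(\<lambda>n. (\<lambda>(s, \<omega>). V (r n s) \<omega>) z) \<longlonglongrightarrow> (\<lambda>(s, \<omega>). V s \<omega>) z"
      by (simp add: z_eq)
  qed
qed

text \<open>Fubini's theorem for \<open>(s, r, \<omega>) \<mapsto> X s \<omega> * X r \<omega>\<close>, which is integrable because its absolute value is
  at most \<open>((X s \<omega>)\<^sup>2 + (X r \<omega>)\<^sup>2) / 2\<close>.\<close>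

lemma second_moment_integral_process:
  fixes X :: "'s \<Rightarrow> 'a \<Rightarrow> real"
  assumes N: "finite_measure N" and M: "prob_space M"
    and X[measurable]: "(\<lambda>(s, \<omega>). X s \<omega>) \<in> borel_measurable (N \<Otimes>\<^sub>M M)"
    and sq: "\<And>s. s \<in> space N \<Longrightarrow> integrable M (\<lambda>\<omega>. (X s \<omega>)\<^sup>2)"
    and bound: "\<And>s. s \<in> space N \<Longrightarrow> (\<integral>\<omega>. (X s \<omega>)\<^sup>2 \<partial>M) \<le> K"
  shows "integrable M (\<lambda>\<omega>. (\<integral>s. X s \<omega> \<partial>N)\<^sup>2)"
    and "(\<integral>\<omega>. (\<integral>s. X s \<omega> \<partial>N)\<^sup>2 \<partial>M)
      = (\<integral>z. (\<integral>\<omega>. X (fst z) \<omega> * X (snd z) \<omega> \<partial>M) \<partial>(N \<Otimes>\<^sub>M N))"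
    and "integrable (N \<Otimes>\<^sub>M N) (\<lambda>z. \<integral>\<omega>. X (fst z) \<omega> * X (snd z) \<omega> \<partial>M)"
proof -
  interpret N: finite_measure N by fact
  interpret M: prob_space M by fact
  interpret NN: pair_sigma_finite N N ..
  interpret P: finite_measure "N \<Otimes>\<^sub>M N" by (rule finite_measure_pair_measure; fact)
  interpret PM: pair_sigma_finite "N \<Otimes>\<^sub>M N" M ..
  define g where "g z \<omega> = X (fst z) \<omega> * X (snd z) \<omega>" for z \<omega>
  have X1[measurable]: "(\<lambda>x. X (f x) (h x)) \<in> borel_measurable L"
    if "f \<in> measurable L N" "h \<in> measurable L M" for L :: "'b measure" and f h
    using measurable_compose[OF measurable_Pair[OF that] X] by simp
  have g[measurable]: "case_prod g \<in> borel_measurable ((N \<Otimes>\<^sub>M N) \<Otimes>\<^sub>M M)"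
    unfolding g_def by measurable
  have g_int: "integrable ((N \<Otimes>\<^sub>M N) \<Otimes>\<^sub>M M) (case_prod g)"
  proof (rule integrableI_bounded)
    have "(\<integral>\<^sup>+x. ennreal (norm (case_prod g x)) \<partial>((N \<Otimes>\<^sub>M N) \<Otimes>\<^sub>M M))
        = (\<integral>\<^sup>+z. (\<integral>\<^sup>+\<omega>. ennreal \<bar>g z \<omega>\<bar> \<partial>M) \<partial>(N \<Otimes>\<^sub>M N))"
      by (subst M.nn_integral_fst[symmetric]) simp_all
    also have "\<dots> \<le> (\<integral>\<^sup>+z. ennreal K \<partial>(N \<Otimes>\<^sub>M N))"
    proof (rule nn_integral_mono)
      fix z assume "z \<in> space (N \<Otimes>\<^sub>M N)"
      then have z: "fst z \<in> space N" "snd z \<in> space N" by (auto simp: space_pair_measure)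
      have "(\<integral>\<^sup>+\<omega>. ennreal \<bar>g z \<omega>\<bar> \<partial>M) \<le> (\<integral>\<^sup>+\<omega>. ennreal (((X (fst z) \<omega>)\<^sup>2 + (X (snd z) \<omega>)\<^sup>2) / 2) \<partial>M)"
      proof (intro nn_integral_mono ennreal_leI)
        fix \<omega>
        have "0 \<le> (\<bar>X (fst z) \<omega>\<bar> - \<bar>X (snd z) \<omega>\<bar>)\<^sup>2" by simp
        then show "\<bar>g z \<omega>\<bar> \<le> ((X (fst z) \<omega>)\<^sup>2 + (X (snd z) \<omega>)\<^sup>2) / 2"
          unfolding power2_diff by (simp add: g_def abs_mult)
      qed
      also have "\<dots> = ennreal (\<integral>\<omega>. ((X (fst z) \<omega>)\<^sup>2 + (X (snd z) \<omega>)\<^sup>2) / 2 \<partial>M)"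
        using sq[OF z(1)] sq[OF z(2)] by (intro nn_integral_eq_integral) auto
      also have "\<dots> \<le> ennreal K"
        using sq[OF z(1)] sq[OF z(2)] bound[OF z(1)] bound[OF z(2)] by (intro ennreal_leI) simp
      finally show "(\<integral>\<^sup>+\<omega>. ennreal \<bar>g z \<omega>\<bar> \<partial>M) \<le> ennreal K" .
    qed
    also have "\<dots> < \<infinity>"
      by (simp add: ennreal_mult_eq_top_iff P.emeasure_finite less_top[symmetric])
    finally show "(\<integral>\<^sup>+x. ennreal (norm (case_prod g x)) \<partial>((N \<Otimes>\<^sub>M N) \<Otimes>\<^sub>M M)) < \<infinity>" .
  qed measurable
  have AE_eq: "AE \<omega> in M. (\<integral>z. g z \<omega> \<partial>(N \<Otimes>\<^sub>M N)) = (\<integral>s. X s \<omega> \<partial>N)\<^sup>2"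
    using PM.AE_integrable_snd[OF g_int]
  proof eventually_elim
    case (elim \<omega>)
    from NN.integral_fst'[OF elim] show ?case
      by (simp add: g_def power2_eq_square)
  qed
  have meas[measurable]: "(\<lambda>\<omega>. \<integral>s. X s \<omega> \<partial>N) \<in> borel_measurable M"
    by (intro N.borel_measurable_lebesgue_integral) measurable
  show "integrable M (\<lambda>\<omega>. (\<integral>s. X s \<omega> \<partial>N)\<^sup>2)"
    by (rule integrable_cong_AE_imp[OF PM.integrable_snd[OF g_int]]) (use AE_eq in auto)
  have "(\<integral>\<omega>. (\<integral>s. X s \<omega> \<partial>N)\<^sup>2 \<partial>M) = (\<integral>\<omega>. (\<integral>z. g z \<omega> \<partial>(N \<Otimes>\<^sub>M N)) \<partial>M)"
    using AE_eq borel_measurable_integrable[OF PM.integrable_snd[OF g_int]]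
    by (intro integral_cong_AE) auto
  also have "\<dots> = (\<integral>z. (\<integral>\<omega>. g z \<omega> \<partial>M) \<partial>(N \<Otimes>\<^sub>M N))"
    using PM.integral_snd[OF g_int] PM.integral_fst[OF g_int] by simp
  finally show "(\<integral>\<omega>. (\<integral>s. X s \<omega> \<partial>N)\<^sup>2 \<partial>M)
      = (\<integral>z. (\<integral>\<omega>. X (fst z) \<omega> * X (snd z) \<omega> \<partial>M) \<partial>(N \<Otimes>\<^sub>M N))"
    by (simp add: g_def)
  show "integrable (N \<Otimes>\<^sub>M N) (\<lambda>z. \<integral>\<omega>. X (fst z) \<omega> * X (snd z) \<omega> \<partial>M)"
    using PM.integrable_fst[OF g_int] by (simp add: g_def)
qed

lemma finite_measure_restrict_lborel_Icc: "finite_measure (restrict_space lborel {a..b::real})"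
  by (rule finite_measureI) (simp add: space_restrict_space emeasure_restrict_space emeasure_lborel_Icc_eq)

text \<open>These moments are all that the convergence of the quadratic variation needs of Brownian motion.
  Continuity of every path, and a time axis that is the whole line, avoid exceptional sets in the
  measurability arguments.\<close>

locale brownian_increments = prob_space M for M :: "'a measure" +
  fixes V :: "real \<Rightarrow> 'a \<Rightarrow> real"
  assumes V_measurable[measurable]: "\<And>s. V s \<in> borel_measurable M"
    and V_continuous: "\<And>\<omega>. \<omega> \<in> space M \<Longrightarrow> continuous_on UNIV (\<lambda>s. V s \<omega>)"
    and increment_moment2: "\<And>s t. 0 \<le> s \<Longrightarrow> s \<le> t \<Longrightarrow>
      has_bochner_integral M (\<lambda>\<omega>. (V t \<omega> - V s \<omega>)\<^sup>2) (t - s)"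
    and increment_moment4: "\<And>s t. 0 \<le> s \<Longrightarrow> s \<le> t \<Longrightarrow>
      has_bochner_integral M (\<lambda>\<omega>. (V t \<omega> - V s \<omega>) ^ 4) (3 * (t - s)\<^sup>2)"
    and increments_squared_uncorrelated: "\<And>r u s t. 0 \<le> r \<Longrightarrow> r \<le> u \<Longrightarrow> u \<le> s \<Longrightarrow> s \<le> t \<Longrightarrow>
      (\<integral>\<omega>. ((V u \<omega> - V r \<omega>)\<^sup>2 - (u - r)) * ((V t \<omega> - V s \<omega>)\<^sup>2 - (t - s)) \<partial>M) = 0"
begin

lemma compensated_square_second_moment:
  assumes "0 \<le> s" "s \<le> t"
  shows "has_bochner_integral M (\<lambda>\<omega>. ((V t \<omega> - V s \<omega>)\<^sup>2 - (t - s))\<^sup>2) (2 * (t - s)\<^sup>2)"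
proof -
  have "has_bochner_integral M (\<lambda>\<omega>. (V t \<omega> - V s \<omega>) ^ 4 - 2 * (t - s) * (V t \<omega> - V s \<omega>)\<^sup>2 + (t - s)\<^sup>2)
      (3 * (t - s)\<^sup>2 - 2 * (t - s) * (t - s) + (t - s)\<^sup>2)"
    by (intro has_bochner_integral_add has_bochner_integral_diff has_bochner_integral_mult_right
        increment_moment2 increment_moment4 assms) (simp add: has_bochner_integral_iff prob_space)
  moreover have "x ^ 4 - 2 * d * x\<^sup>2 + d\<^sup>2 = (x\<^sup>2 - d)\<^sup>2" for x d :: real
    by (simp add: power2_eq_square power4_eq_xxxx algebra_simps)
  moreover have "3 * (t - s)\<^sup>2 - 2 * (t - s) * (t - s) + (t - s)\<^sup>2 = 2 * (t - s)\<^sup>2"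
    by (simp add: power2_eq_square algebra_simps)
  ultimately show ?thesis by (simp only:)
qed

lemma joint_measurable[measurable]: "(\<lambda>(s, \<omega>). V s \<omega>) \<in> borel_measurable (borel \<Otimes>\<^sub>M M)"
  by (intro borel_measurable_continuous_process V_measurable V_continuous)

lemma V_measurable_compose[measurable]:
  "f \<in> borel_measurable N \<Longrightarrow> h \<in> measurable N M \<Longrightarrow> (\<lambda>x. V (f x) (h x)) \<in> borel_measurable N"
  using measurable_compose[OF measurable_Pair joint_measurable, of f N h] by simp

text \<open>The compensated squares at \<open>s\<close> and \<open>r\<close> belong to disjoint increments, hence are uncorrelated, unless
  \<open>\<bar>s - r\<bar> \<le> e\<close>; in that case their product has mean at most \<open>2 * e\<^sup>2\<close>. The strip where this
  happens has area at most \<open>2 * e * u\<close>. After division by \<open>e\<^sup>2\<close> the second moment is of order \<open>e\<close>.\<close>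

lemma compensated_squares_second_moment_bound:
  assumes u: "0 \<le> u" "u \<le> T" and e: "0 < e"
  defines "X \<equiv> \<lambda>s \<omega>. (V (min (s + e) T) \<omega> - V s \<omega>)\<^sup>2 - (min (s + e) T - s)"
  shows "integrable M (\<lambda>\<omega>. (integral {0..u} (\<lambda>s. X s \<omega>))\<^sup>2)"
    and "(\<integral>\<omega>. (integral {0..u} (\<lambda>s. X s \<omega>))\<^sup>2 \<partial>M) \<le> 4 * e ^ 3 * u"
proof -
  define N where "N = restrict_space lborel {0..u}"
  interpret N: finite_measure N unfolding N_def by (rule finite_measure_restrict_lborel_Icc)
  interpret NN: pair_sigma_finite N N ..
  have space_N: "space N = {0..u}" by (simp add: N_def space_restrict_space)
  have sets_N[measurable_cong]: "sets N = sets (restrict_space borel {0..u})"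
    by (simp add: N_def sets_restrict_space)
  have id_N[measurable]: "(\<lambda>s. s) \<in> borel_measurable N"
    unfolding N_def by (intro measurable_restrict_space1) simp
  have f1[measurable]: "fst \<in> borel_measurable (N \<Otimes>\<^sub>M L)" for L :: "'b measure"
    using measurable_compose[OF measurable_fst id_N] by simp
  have f2[measurable]: "snd \<in> borel_measurable (L \<Otimes>\<^sub>M N)" for L :: "'b measure"
    using measurable_compose[OF measurable_snd id_N] by simp
  have X[measurable]: "(\<lambda>(s, \<omega>). X s \<omega>) \<in> borel_measurable (N \<Otimes>\<^sub>M M)"
    unfolding X_def split_beta' by measurable
  have sq: "integrable M (\<lambda>\<omega>. (X s \<omega>)\<^sup>2)" and bound: "(\<integral>\<omega>. (X s \<omega>)\<^sup>2 \<partial>M) \<le> 2 * e\<^sup>2"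
    if "s \<in> space N" for s
  proof -
    have s: "0 \<le> s" "s \<le> min (s + e) T" using that u e by (auto simp: space_N)
    note B = compensated_square_second_moment[OF s]
    show "integrable M (\<lambda>\<omega>. (X s \<omega>)\<^sup>2)" using B unfolding X_def has_bochner_integral_iff by simp
    have "(\<integral>\<omega>. (X s \<omega>)\<^sup>2 \<partial>M) = 2 * (min (s + e) T - s)\<^sup>2"
      using B unfolding X_def has_bochner_integral_iff by simp
    also have "\<dots> \<le> 2 * e\<^sup>2" using s by (intro mult_left_mono power_mono) auto
    finally show "(\<integral>\<omega>. (X s \<omega>)\<^sup>2 \<partial>M) \<le> 2 * e\<^sup>2" .
  qed
  note SM = second_moment_integral_process[OF N.finite_measure_axioms prob_space_axioms X sq bound]
  have int_eq: "(\<integral>s. X s \<omega> \<partial>N) = integral {0..u} (\<lambda>s. X s \<omega>)" if "\<omega> \<in> space M" for \<omega>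
  proof -
    have "continuous_on {0..u} (\<lambda>s. X s \<omega>)"
      unfolding X_def
      by (intro continuous_intros continuous_on_compose2[OF V_continuous[OF that]]) auto
    from set_integral_continuous_eq_integral[OF this] show ?thesis
      unfolding N_def by (subst integral_restrict_space) (simp_all add: set_lebesgue_integral_def)
  qed
  show "integrable M (\<lambda>\<omega>. (integral {0..u} (\<lambda>s. X s \<omega>))\<^sup>2)"
    by (rule Bochner_Integration.integrable_cong[THEN iffD1, OF refl _ SM(1)]) (simp_all add: int_eq)
  have le: "(\<integral>\<omega>. X s \<omega> * X r \<omega> \<partial>M) \<le> 2 * e\<^sup>2 * indicator {s - e..s + e} r"
    if sr: "s \<in> {0..u}" "r \<in> {0..u}" for s r
  proof (cases "\<bar>s - r\<bar> \<le> e")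
    case True
    have "(\<integral>\<omega>. X s \<omega> * X r \<omega> \<partial>M) \<le> (\<integral>\<omega>. ((X s \<omega>)\<^sup>2 + (X r \<omega>)\<^sup>2) / 2 \<partial>M)"
    proof (rule integral_mono')
      show "integrable M (\<lambda>\<omega>. ((X s \<omega>)\<^sup>2 + (X r \<omega>)\<^sup>2) / 2)"
        using sq sr by (simp add: space_N)
      show "X s \<omega> * X r \<omega> \<le> ((X s \<omega>)\<^sup>2 + (X r \<omega>)\<^sup>2) / 2" for \<omega>
        using sum_squares_bound[of "X s \<omega>" "X r \<omega>"] by simp
    qed simp
    also have "\<dots> \<le> 2 * e\<^sup>2"
      using sq[of s] sq[of r] bound[of s] bound[of r] sr by (simp add: space_N)
    finally show ?thesis using True by (auto simp: indicator_def abs_le_iff)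
  next
    case False
    have "(\<integral>\<omega>. X s \<omega> * X r \<omega> \<partial>M) = 0"
    proof (cases "s < r")
      case True
      then show ?thesis
        unfolding X_def using sr u e False by (intro increments_squared_uncorrelated) auto
    next
      case 2: False
      then have "(\<integral>\<omega>. X r \<omega> * X s \<omega> \<partial>M) = 0"
        unfolding X_def using sr u e False by (intro increments_squared_uncorrelated) auto
      then show ?thesis by (simp add: mult.commute)
    qed
    then show ?thesis by simp
  qed
  have "(\<integral>\<omega>. (integral {0..u} (\<lambda>s. X s \<omega>))\<^sup>2 \<partial>M) = (\<integral>\<omega>. (\<integral>s. X s \<omega> \<partial>N)\<^sup>2 \<partial>M)"
    by (intro Bochner_Integration.integral_cong) (simp_all add: int_eq)
  also have "\<dots> = (\<integral>z. (\<integral>\<omega>. X (fst z) \<omega> * X (snd z) \<omega> \<partial>M) \<partial>(N \<Otimes>\<^sub>M N))" by (rule SM(2))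
  also have "\<dots> = (\<integral>s. (\<integral>r. (\<integral>\<omega>. X s \<omega> * X r \<omega> \<partial>M) \<partial>N) \<partial>N)"
    using NN.integral_fst'[OF SM(3)] by simp
  also have "\<dots> \<le> (\<integral>s. 4 * e ^ 3 \<partial>N)"
  proof (rule integral_mono_AE)
    show "integrable N (\<lambda>s. \<integral>r. (\<integral>\<omega>. X s \<omega> * X r \<omega> \<partial>M) \<partial>N)"
      using NN.integrable_fst'[OF SM(3)] by simp
    have "AE s in N. integrable N (\<lambda>r. \<integral>\<omega>. X s \<omega> * X r \<omega> \<partial>M)"
      using NN.AE_integrable_fst'[OF SM(3)] by simp
    then show "AE s in N. (\<integral>r. (\<integral>\<omega>. X s \<omega> * X r \<omega> \<partial>M) \<partial>N) \<le> 4 * e ^ 3"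
      using AE_space
    proof eventually_elim
      case (elim s)
      have ind: "(\<lambda>r. indicator {s - e..s + e} r :: real) \<in> borel_measurable N"
        unfolding N_def by (intro measurable_restrict_space1) simp
      have ind_int: "integrable N (\<lambda>r. indicator {s - e..s + e} r :: real)"
        by (rule N.integrable_const_bound[where B = 1]) (use ind in \<open>auto simp: indicator_def\<close>)
      have "(\<integral>r. (\<integral>\<omega>. X s \<omega> * X r \<omega> \<partial>M) \<partial>N) \<le> (\<integral>r. 2 * e\<^sup>2 * indicator {s - e..s + e} r \<partial>N)"
        using elim le ind_int by (intro integral_mono) (auto simp: space_N)
      also have "\<dots> = 2 * e\<^sup>2 * (\<integral>r. indicator {s - e..s + e} r \<partial>N)" by simp
      also have "(\<integral>r. indicator {s - e..s + e} r \<partial>N) = (\<integral>r. indicator ({0..u} \<inter> {s - e..s + e}) r \<partial>lborel :: real)"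
      proof -
        have "(\<integral>r. indicator {s - e..s + e} r \<partial>N)
            = (\<integral>r. indicator {0..u} r *\<^sub>R indicator {s - e..s + e} r \<partial>lborel :: real)"
          unfolding N_def by (rule integral_restrict_space) simp
        also have "\<dots> = (\<integral>r. indicator ({0..u} \<inter> {s - e..s + e}) r \<partial>lborel)"
          by (rule Bochner_Integration.integral_cong) (auto simp: indicator_def)
        finally show ?thesis .
      qed
      also have "\<dots> = measure lborel ({0..u} \<inter> {s - e..s + e})" by simp
      also have "\<dots> \<le> measure lborel {s - e..s + e}"
        by (intro measure_mono_fmeasurable) (auto simp: fmeasurable_def emeasure_lborel_Icc_eq)
      also have "\<dots> = 2 * e" using e by simp
      also have "2 * e\<^sup>2 * (2 * e) = 4 * e ^ 3" by (simp add: power2_eq_square power3_eq_cube)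
      finally show ?case using e by (simp add: mult_left_mono)
    qed
  qed simp
  also have "\<dots> = 4 * e ^ 3 * u"
    using u by (simp add: N_def measure_restrict_space space_restrict_space)
  finally show "(\<integral>\<omega>. (integral {0..u} (\<lambda>s. X s \<omega>))\<^sup>2 \<partial>M) \<le> 4 * e ^ 3 * u" .
qed

end

text \<open>The sum of the squares has finite mean, so it converges almost surely and its terms vanish.\<close>

lemma AE_tendsto_zero_of_summable_second_moment:
  fixes Y :: "nat \<Rightarrow> 'a \<Rightarrow> real"
  assumes int: "\<And>n. integrable M (\<lambda>\<omega>. (Y n \<omega>)\<^sup>2)"
    and summ: "summable (\<lambda>n. \<integral>\<omega>. (Y n \<omega>)\<^sup>2 \<partial>M)"
  shows "AE \<omega> in M. (\<lambda>n. Y n \<omega>) \<longlonglongrightarrow> 0"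
proof -
  have [measurable]: "(\<lambda>\<omega>. (Y n \<omega>)\<^sup>2) \<in> borel_measurable M" for n
    using int[of n] by simp
  have "(\<integral>\<^sup>+\<omega>. (\<Sum>n. ennreal ((Y n \<omega>)\<^sup>2)) \<partial>M) = (\<Sum>n. \<integral>\<^sup>+\<omega>. ennreal ((Y n \<omega>)\<^sup>2) \<partial>M)"
    by (rule nn_integral_suminf) measurable
  also have "\<dots> = (\<Sum>n. ennreal (\<integral>\<omega>. (Y n \<omega>)\<^sup>2 \<partial>M))"
    using int by (intro suminf_cong nn_integral_eq_integral) auto
  also have "\<dots> = ennreal (\<Sum>n. \<integral>\<omega>. (Y n \<omega>)\<^sup>2 \<partial>M)"
    by (rule suminf_ennreal2) (use summ in auto)
  finally have "(\<integral>\<^sup>+\<omega>. (\<Sum>n. ennreal ((Y n \<omega>)\<^sup>2)) \<partial>M) \<noteq> \<infinity>" by simp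
  then have "AE \<omega> in M. (\<Sum>n. ennreal ((Y n \<omega>)\<^sup>2)) \<noteq> \<infinity>"
    by (intro nn_integral_noteq_infinite) measurable
  then show ?thesis
  proof eventually_elim
    case (elim \<omega>)
    then have "summable (\<lambda>n. (Y n \<omega>)\<^sup>2)"
      by (intro summable_suminf_not_top) auto
    then have "(\<lambda>n. (Y n \<omega>)\<^sup>2) \<longlonglongrightarrow> 0" by (rule summable_LIMSEQ_zero)
    then have "(\<lambda>n. sqrt ((Y n \<omega>)\<^sup>2)) \<longlonglongrightarrow> sqrt 0" by (rule tendsto_real_sqrt)
    then show ?case by (simp add: tendsto_rabs_zero_iff)
  qed
qed

context brownian_increments
begin

lemma AE_quadratic_variation:
  assumes u: "0 \<le> u" "u \<le> T" and eps: "\<And>n. 0 < \<epsilon> n" "summable \<epsilon>"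
  shows "AE \<omega> in M. (\<lambda>n. integral {0..u} (\<lambda>s. (V (min (s + \<epsilon> n) T) \<omega> - V s \<omega>)\<^sup>2 / \<epsilon> n)) \<longlonglongrightarrow> u"
proof -
  define X where "X n s \<omega> = (V (min (s + \<epsilon> n) T) \<omega> - V s \<omega>)\<^sup>2 - (min (s + \<epsilon> n) T - s)" for n s \<omega>
  define Y where "Y n \<omega> = integral {0..u} (\<lambda>s. X n s \<omega>) / \<epsilon> n" for n \<omega>
  note bnd = compensated_squares_second_moment_bound[OF u eps(1), folded X_def]
  have eps0: "\<epsilon> \<longlonglongrightarrow> 0" using eps(2) by (rule summable_LIMSEQ_zero)
  have Y_int: "integrable M (\<lambda>\<omega>. (Y n \<omega>)\<^sup>2)" for n
    using bnd(1)[of n] by (simp add: Y_def power_divide)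
  have Y_le: "(\<integral>\<omega>. (Y n \<omega>)\<^sup>2 \<partial>M) \<le> 4 * u * \<epsilon> n" for n
  proof -
    have "(\<integral>\<omega>. (Y n \<omega>)\<^sup>2 \<partial>M) = (\<integral>\<omega>. (integral {0..u} (\<lambda>s. X n s \<omega>))\<^sup>2 \<partial>M) / (\<epsilon> n)\<^sup>2"
      by (simp add: Y_def power_divide)
    also have "\<dots> \<le> 4 * (\<epsilon> n) ^ 3 * u / (\<epsilon> n)\<^sup>2"
      using bnd(2)[of n] by (rule divide_right_mono) simp
    also have "\<dots> = 4 * u * \<epsilon> n"
      using eps(1)[of n] by (simp add: power2_eq_square power3_eq_cube)
    finally show ?thesis .
  qed
  have "summable (\<lambda>n. \<integral>\<omega>. (Y n \<omega>)\<^sup>2 \<partial>M)"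
    by (rule summable_comparison_test'[where g = "\<lambda>n. 4 * u * \<epsilon> n" and N = 0])
      (use Y_le eps(2) in \<open>auto intro: summable_mult\<close>)
  with Y_int have "AE \<omega> in M. (\<lambda>n. Y n \<omega>) \<longlonglongrightarrow> 0"
    by (rule AE_tendsto_zero_of_summable_second_moment)
  then show ?thesis
    using AE_space
  proof eventually_elim
    case (elim \<omega>)
    have X: "continuous_on {0..u} (\<lambda>s. X n s \<omega>)" for n
      unfolding X_def
      by (intro continuous_intros continuous_on_compose2[OF V_continuous[OF elim(2)]]) auto
    have "(\<lambda>n. Y n \<omega> + integral {0..u} (\<lambda>s. (min (s + \<epsilon> n) T - s) / \<epsilon> n)) \<longlonglongrightarrow> 0 + u"
      by (intro tendsto_add elim(1) stopped_clock_quotient_tendsto u eps(1) eps0)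
    moreover have "Y n \<omega> + integral {0..u} (\<lambda>s. (min (s + \<epsilon> n) T - s) / \<epsilon> n)
        = integral {0..u} (\<lambda>s. (V (min (s + \<epsilon> n) T) \<omega> - V s \<omega>)\<^sup>2 / \<epsilon> n)" for n
    proof -
      have "Y n \<omega> + integral {0..u} (\<lambda>s. (min (s + \<epsilon> n) T - s) / \<epsilon> n)
          = integral {0..u} (\<lambda>s. X n s \<omega> / \<epsilon> n) + integral {0..u} (\<lambda>s. (min (s + \<epsilon> n) T - s) / \<epsilon> n)"
        by (simp add: Y_def)
      also have "\<dots> = integral {0..u} (\<lambda>s. X n s \<omega> / \<epsilon> n + (min (s + \<epsilon> n) T - s) / \<epsilon> n)"
        using X[of n] eps(1)[of n] by (intro Henstock_Kurzweil_Integration.integral_add[symmetric]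
          integrable_continuous_interval continuous_intros) auto
      finally show ?thesis by (simp add: X_def add_divide_distrib[symmetric])
    qed
    ultimately show ?case by simp
  qed
qed

text \<open>One null set serves all weights \<open>y\<close>, and so the weight may depend on \<open>\<omega>\<close> in any way. This is where
  anticipating integrands become harmless.\<close>

lemma AE_weighted_quadratic_variation:
  assumes T: "0 \<le> T" and eps: "\<And>n. 0 < \<epsilon> n" "summable \<epsilon>"
  shows "AE \<omega> in M. \<forall>y. continuous_on {0..T} y \<longrightarrow>
    (\<lambda>n. integral {0..T} (\<lambda>s. y s * ((V (min (s + \<epsilon> n) T) \<omega> - V s \<omega>)\<^sup>2 / \<epsilon> n)))
      \<longlonglongrightarrow> integral {0..T} y"
proof -
  have "AE \<omega> in M. \<forall>(k::nat) (N::nat). 0 < N \<longrightarrow> k \<le> N \<longrightarrow>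
      (\<lambda>n. integral {0..real k * T / real N} (\<lambda>s. (V (min (s + \<epsilon> n) T) \<omega> - V s \<omega>)\<^sup>2 / \<epsilon> n))
        \<longlonglongrightarrow> real k * T / real N"
  proof (unfold AE_all_countable, intro allI)
    fix k N :: nat
    show "AE \<omega> in M. 0 < N \<longrightarrow> k \<le> N \<longrightarrow>
      (\<lambda>n. integral {0..real k * T / real N} (\<lambda>s. (V (min (s + \<epsilon> n) T) \<omega> - V s \<omega>)\<^sup>2 / \<epsilon> n))
        \<longlonglongrightarrow> real k * T / real N"
    proof (cases "0 < N \<and> k \<le> N")
      case True
      then have "real k * T / real N \<le> T"
        using T mult_right_mono[of "real k" "real N" T] by (auto simp: field_simps)
      then have "AE \<omega> in M. (\<lambda>n. integral {0..real k * T / real N}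
          (\<lambda>s. (V (min (s + \<epsilon> n) T) \<omega> - V s \<omega>)\<^sup>2 / \<epsilon> n)) \<longlonglongrightarrow> real k * T / real N"
        using T by (intro AE_quadratic_variation eps) auto
      then show ?thesis by eventually_elim simp
    qed auto
  qed
  then show ?thesis
    using AE_space
  proof eventually_elim
    case (elim \<omega>)
    have q: "continuous_on {0..T} (\<lambda>s. (V (min (s + \<epsilon> n) T) \<omega> - V s \<omega>)\<^sup>2 / \<epsilon> n)" for n
      using eps(1)[of n]
      by (intro continuous_intros continuous_on_compose2[OF V_continuous[OF elim(2)]]) auto
    show ?case
    proof (intro allI impI)
      fix y :: "real \<Rightarrow> real" assume y: "continuous_on {0..T} y"
      show "(\<lambda>n. integral {0..T} (\<lambda>s. y s * ((V (min (s + \<epsilon> n) T) \<omega> - V s \<omega>)\<^sup>2 / \<epsilon> n)))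
          \<longlonglongrightarrow> integral {0..T} y"
        by (rule weighted_integral_tendsto[OF T y q])
          (use elim(1) eps(1)[THEN less_imp_le] in auto)
    qed
  qed
qed

end

section \<open>A continuous modification of Brownian motion\<close>

context brownian_motion
begin

lemma W_borel_measurable: "0 \<le> s \<Longrightarrow> W s \<in> borel_measurable M"
  using W_adapted subalgebra_F by (rule measurable_from_subalg[rotated])

lemma increment_has_bochner_integral:
  assumes st: "0 \<le> s" "s \<le> t"
  shows "has_bochner_integral M (\<lambda>\<omega>. (W t \<omega> - W s \<omega>)\<^sup>2) (t - s)"
    and "has_bochner_integral M (\<lambda>\<omega>. (W t \<omega> - W s \<omega>) ^ 4) (3 * (t - s)\<^sup>2)"
proof -
  have "has_bochner_integral M (\<lambda>\<omega>. (W t \<omega> - W s \<omega>) ^ (2 * k))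
      (fact (2 * k) / ((2 / (sqrt (t - s))\<^sup>2) ^ k * fact k))" if "s < t" for k
  proof -
    define c :: real where "c = fact (2 * k) / ((2 / (sqrt (t - s))\<^sup>2) ^ k * fact k)"
    have D: "distributed M lborel (\<lambda>\<omega>. W t \<omega> - W s \<omega>) (normal_density 0 (sqrt (t - s)))"
      using st that by (intro W_normal)
    have N: "has_bochner_integral lborel (\<lambda>x. normal_density 0 (sqrt (t - s)) x * x ^ (2 * k)) c"
      using normal_moment_even[of "sqrt (t - s)" 0 k] that by (simp add: c_def)
    have "integrable M (\<lambda>\<omega>. (W t \<omega> - W s \<omega>) ^ (2 * k))"
      using N by (subst distributed_integrable[OF D, symmetric]) (auto simp: has_bochner_integral_iff)
    moreover have "(\<integral>\<omega>. (W t \<omega> - W s \<omega>) ^ (2 * k) \<partial>M) = c"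
      using N by (subst distributed_integral[OF D, symmetric]) (auto simp: has_bochner_integral_iff)
    ultimately show ?thesis by (simp add: has_bochner_integral_iff c_def)
  qed
  note even = this
  have "has_bochner_integral M (\<lambda>\<omega>. (W t \<omega> - W s \<omega>)\<^sup>2) (t - s) \<and>
    has_bochner_integral M (\<lambda>\<omega>. (W t \<omega> - W s \<omega>) ^ 4) (3 * (t - s)\<^sup>2)"
  proof (cases "s = t")
    case False
    define d where "d = t - s"
    have d: "0 < d" "(sqrt d)\<^sup>2 = d" using False st by (auto simp: d_def)
    have "fact (2 * 1) / ((2 / d) ^ 1 * fact 1) = d" using d by simp
    moreover have "fact (2 * 2) / ((2 / d) ^ 2 * fact 2) = 3 * d\<^sup>2"
      using d by (simp add: fact_numeral power_divide)
    ultimately show ?thesis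
      using even[of 1] even[of 2] False st unfolding d_def[symmetric] d(2) by simp
  qed (simp add: has_bochner_integral_iff)
  then show "has_bochner_integral M (\<lambda>\<omega>. (W t \<omega> - W s \<omega>)\<^sup>2) (t - s)"
    "has_bochner_integral M (\<lambda>\<omega>. (W t \<omega> - W s \<omega>) ^ 4) (3 * (t - s)\<^sup>2)" by auto
qed

text \<open>The earlier increment is measurable with respect to \<open>F s\<close>, the later one is independent of it.\<close>

lemma increments_squared_uncorrelated_W:
  assumes "0 \<le> r" "r \<le> u" "u \<le> s" "s \<le> t"
  shows "(\<integral>\<omega>. ((W u \<omega> - W r \<omega>)\<^sup>2 - (u - r)) * ((W t \<omega> - W s \<omega>)\<^sup>2 - (t - s)) \<partial>M) = 0"
proof (cases "s = t")
  case False
  with assms have st: "0 \<le> s" "s < t" "0 \<le> u" "u \<le> t" by auto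
  have space_F: "space (F q) = space M" if "0 \<le> q" for q
    using subalgebra_F[OF that] by (simp add: subalgebra_def)
  have WF: "W q \<in> borel_measurable (F s)" if "0 \<le> q" "q \<le> s" for q
    using W_adapted[OF that(1)] F_mono[OF that] space_F[of q] space_F[of s] that
    by (intro measurable_mono[THEN subsetD, of borel borel "F q" "F s"]) auto
  have WuF: "(\<lambda>\<omega>. W u \<omega> - W r \<omega>) \<in> borel_measurable (F s)"
    using assms by (intro borel_measurable_diff WF) auto
  have "indep_var borel (\<lambda>\<omega>. W u \<omega> - W r \<omega>) borel (\<lambda>\<omega>. W t \<omega> - W s \<omega>)"
    unfolding indep_var_eq
  proof (intro conjI)
    show "random_variable borel (\<lambda>\<omega>. W u \<omega> - W r \<omega>)" "random_variable borel (\<lambda>\<omega>. W t \<omega> - W s \<omega>)"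
      using assms by (auto intro!: borel_measurable_diff W_borel_measurable)
    have 1: "sigma_sets (space M) {(\<lambda>\<omega>. W u \<omega> - W r \<omega>) -` A \<inter> space M |A. A \<in> sets borel} \<subseteq> sets (F s)"
      unfolding space_F[OF st(1), symmetric]
      by (rule sets.sigma_sets_subset) (use measurable_sets[OF WuF] in auto)
    have 2: "sigma_sets (space M) {(\<lambda>\<omega>. W t \<omega> - W s \<omega>) -` A \<inter> space M |A. A \<in> sets borel}
        = sets (vimage_algebra (space M) (\<lambda>\<omega>. W t \<omega> - W s \<omega>) borel)"
      by (rule sets_vimage_algebra[symmetric])
    show "indep_set (sigma_sets (space M) {(\<lambda>\<omega>. W u \<omega> - W r \<omega>) -` A \<inter> space M |A. A \<in> sets borel})
       (sigma_sets (space M) {(\<lambda>\<omega>. W t \<omega> - W s \<omega>) -` A \<inter> space M |A. A \<in> sets borel})"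
      unfolding 2 using W_indep[OF st(1,2)] 1 unfolding indep_sets2_eq by blast
  qed
  then have "indep_var borel ((\<lambda>x. x\<^sup>2 - (u - r)) \<circ> (\<lambda>\<omega>. W u \<omega> - W r \<omega>))
      borel ((\<lambda>x. x\<^sup>2 - (t - s)) \<circ> (\<lambda>\<omega>. W t \<omega> - W s \<omega>))"
    by (rule indep_var_compose) auto
  then have ind: "indep_var borel (\<lambda>\<omega>. (W u \<omega> - W r \<omega>)\<^sup>2 - (u - r)) borel (\<lambda>\<omega>. (W t \<omega> - W s \<omega>)\<^sup>2 - (t - s))"
    by (simp add: o_def)
  have int: "integrable M (\<lambda>\<omega>. (W b \<omega> - W a \<omega>)\<^sup>2 - (b - a))"
    and zero: "(\<integral>\<omega>. (W b \<omega> - W a \<omega>)\<^sup>2 - (b - a) \<partial>M) = 0" if "0 \<le> a" "a \<le> b" for a b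
    using increment_has_bochner_integral(1)[OF that] by (auto simp: has_bochner_integral_iff prob_space)
  show ?thesis
    using indep_var_lebesgue_integral[OF ind int int] zero[of r u] assms by simp
qed simp

text \<open>The paths of \<open>W\<close> are continuous only almost surely; redefining them on a null set, and freezing
  them at negative times, gives a process all of whose paths are continuous on the line.\<close>

lemma continuous_modification:
  obtains V where "brownian_increments M V"
    and "AE \<omega> in M. \<forall>s\<ge>0. V s \<omega> = W s \<omega>"
proof -
  have "AE \<omega> in M. continuous_on {0..} (\<lambda>t. W t \<omega>)" by (rule W_continuous)
  then obtain N where N: "N \<in> null_sets M" "{\<omega> \<in> space M. \<not> continuous_on {0..} (\<lambda>t. W t \<omega>)} \<subseteq> N"
    by (auto elim!: AE_E simp: null_sets_def)
  define G where "G = space M - N"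
  have G[measurable]: "G \<in> sets M" using N(1) by (auto simp: G_def)
  have G_AE: "AE \<omega> in M. \<omega> \<in> G"
    using AE_not_in[OF N(1)] AE_space by eventually_elim (simp add: G_def)
  define V where "V s \<omega> = (if \<omega> \<in> G then W (max 0 s) \<omega> else 0)" for s \<omega>
  have eq: "AE \<omega> in M. \<forall>s\<ge>0. V s \<omega> = W s \<omega>"
    using G_AE by eventually_elim (auto simp: V_def)
  have [measurable]: "W (max 0 s) \<in> borel_measurable M" for s by (rule W_borel_measurable) simp
  have V[measurable]: "V s \<in> borel_measurable M" for s unfolding V_def by measurable
  have "brownian_increments M V"
  proof unfold_locales
    show "V s \<in> borel_measurable M" for s by (rule V)
    show "continuous_on UNIV (\<lambda>s. V s \<omega>)" if "\<omega> \<in> space M" for \<omega>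
    proof (cases "\<omega> \<in> G")
      case True
      then have "continuous_on {0..} (\<lambda>t. W t \<omega>)" using N by (auto simp: G_def)
      then have "continuous_on UNIV (\<lambda>s. W (max 0 s) \<omega>)"
        by (rule continuous_on_compose2) (auto intro!: continuous_intros)
      then show ?thesis using True by (simp add: V_def)
    qed (simp add: V_def)
  next
    fix s t :: real assume st: "0 \<le> s" "s \<le> t"
    have "AE \<omega> in M. W t \<omega> - W s \<omega> = V t \<omega> - V s \<omega>"
      using eq by eventually_elim (use st in auto)
    then have *: "AE \<omega> in M. (W t \<omega> - W s \<omega>) ^ k = (V t \<omega> - V s \<omega>) ^ k" for k :: nat
      by eventually_elim simp
    have **: "has_bochner_integral M (\<lambda>\<omega>. (V t \<omega> - V s \<omega>) ^ k) c"
      if "has_bochner_integral M (\<lambda>\<omega>. (W t \<omega> - W s \<omega>) ^ k) c" for k :: nat and c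
      by (rule has_bochner_integralI_AE[OF that _ *]) measurable
    show "has_bochner_integral M (\<lambda>\<omega>. (V t \<omega> - V s \<omega>)\<^sup>2) (t - s)"
      "has_bochner_integral M (\<lambda>\<omega>. (V t \<omega> - V s \<omega>) ^ 4) (3 * (t - s)\<^sup>2)"
      using st by (auto intro!: ** increment_has_bochner_integral)
  next
    fix r u s t :: real assume rust: "0 \<le> r" "r \<le> u" "u \<le> s" "s \<le> t"
    have [measurable]: "W r \<in> borel_measurable M" "W u \<in> borel_measurable M"
      "W s \<in> borel_measurable M" "W t \<in> borel_measurable M"
      using rust by (auto intro: W_borel_measurable)
    have "(\<integral>\<omega>. ((V u \<omega> - V r \<omega>)\<^sup>2 - (u - r)) * ((V t \<omega> - V s \<omega>)\<^sup>2 - (t - s)) \<partial>M)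
        = (\<integral>\<omega>. ((W u \<omega> - W r \<omega>)\<^sup>2 - (u - r)) * ((W t \<omega> - W s \<omega>)\<^sup>2 - (t - s)) \<partial>M)"
    proof (rule integral_cong_AE)
      show "AE \<omega> in M. ((V u \<omega> - V r \<omega>)\<^sup>2 - (u - r)) * ((V t \<omega> - V s \<omega>)\<^sup>2 - (t - s))
          = ((W u \<omega> - W r \<omega>)\<^sup>2 - (u - r)) * ((W t \<omega> - W s \<omega>)\<^sup>2 - (t - s))"
        using eq by eventually_elim (use rust in auto)
    qed measurable
    also have "\<dots> = 0" using rust by (rule increments_squared_uncorrelated_W)
    finally show "(\<integral>\<omega>. ((V u \<omega> - V r \<omega>)\<^sup>2 - (u - r)) * ((V t \<omega> - V s \<omega>)\<^sup>2 - (t - s)) \<partial>M) = 0" .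
  qed
  then show thesis using eq by (rule that)
qed

end

section \<open>Forward integrals: existence from pathwise limits, and locality\<close>

text \<open>Localizing sequences are compared almost everywhere on the product, forward integrals path by path;
  this and the following lemma translate.\<close>

lemma AE_lborel_pair_slices:
  assumes M: "sigma_finite_measure M" and AE: "AE (s :: real, \<omega>) in lborel \<Otimes>\<^sub>M M. Q s \<omega>"
  shows "AE \<omega> in M. AE s in lborel. Q s \<omega>"
proof -
  interpret M: sigma_finite_measure M by fact
  interpret P: pair_sigma_finite M lborel ..
  interpret Q: pair_sigma_finite lborel M ..
  have Q_AE: "AE (s, \<omega>) in distr (M \<Otimes>\<^sub>M lborel) (lborel \<Otimes>\<^sub>M M) (\<lambda>(x, y). (y, x)). Q s \<omega>"
    using AE by (subst Q.distr_pair_swap[symmetric])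
  have "AE z in M \<Otimes>\<^sub>M lborel. (\<lambda>(s, \<omega>). Q s \<omega>) (case z of (x, y) \<Rightarrow> (y, x))"
    by (rule AE_distrD[OF measurable_pair_swap' Q_AE])
  then have "AE z in M \<Otimes>\<^sub>M lborel. Q (snd z) (fst z)"
    by (simp add: split_beta')
  from P.AE_pair[OF this] show ?thesis by simp
qed

lemma AE_lborel_pair_const:
  assumes M: "sigma_finite_measure M" and AE: "AE \<omega> in M. Q \<omega>"
  shows "AE (s :: real, \<omega>) in lborel \<Otimes>\<^sub>M M. Q \<omega>"
proof -
  interpret M: sigma_finite_measure M by fact
  obtain N where N: "{\<omega> \<in> space M. \<not> Q \<omega>} \<subseteq> N" "N \<in> sets M" "emeasure M N = 0"
    using AE by (rule AE_E)
  have "(UNIV :: real set) \<times> N \<in> null_sets (lborel \<Otimes>\<^sub>M M)"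
    using N(2,3) by (auto simp: null_sets_def M.emeasure_pair_measure_Times)
  then show ?thesis
    by (rule AE_I') (use N(1) in \<open>auto simp: space_pair_measure\<close>)
qed

lemma (in prob_space) AE_tendsto_imp_tendsto_measure:
  fixes X :: "nat \<Rightarrow> 'a \<Rightarrow> real"
  assumes X[measurable]: "\<And>n. X n \<in> borel_measurable M" and Z[measurable]: "Z \<in> borel_measurable M"
    and lim: "AE \<omega> in M. (\<lambda>n. X n \<omega>) \<longlonglongrightarrow> Z \<omega>" and d: "0 < \<delta>"
  shows "(\<lambda>n. measure M {\<omega> \<in> space M. \<delta> < \<bar>X n \<omega> - Z \<omega>\<bar>}) \<longlonglongrightarrow> 0"
proof -
  define B where "B n = {\<omega> \<in> space M. \<delta> < \<bar>X n \<omega> - Z \<omega>\<bar>}" for n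
  have B[measurable]: "B n \<in> sets M" for n unfolding B_def by measurable
  have "(\<lambda>n. \<integral>\<omega>. indicator (B n) \<omega> \<partial>M) \<longlonglongrightarrow> (\<integral>\<omega>. 0 \<partial>M :: real)"
  proof (rule integral_dominated_convergence[where w = "\<lambda>_. 1"])
    show "AE \<omega> in M. (\<lambda>n. indicator (B n) \<omega> :: real) \<longlonglongrightarrow> 0"
      using lim
    proof eventually_elim
      case (elim \<omega>)
      have "eventually (\<lambda>n. dist (X n \<omega>) (Z \<omega>) < \<delta>) sequentially"
        using elim d by (rule tendstoD)
      then have "eventually (\<lambda>n. indicator (B n) \<omega> = (0::real)) sequentially"
        by eventually_elim (auto simp: B_def dist_real_def indicator_def)
      then show ?case by (rule tendsto_eventually)
    qed
  qed (auto simp: indicator_def)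
  then show ?thesis by (simp add: B_def)
qed

context brownian_motion
begin

text \<open>Only the paths of the modification are known to be jointly measurable, so the approximation is
  formed with them first and then changed on a null set.\<close>

lemma forward_approx_measurable:
  assumes e: "0 \<le> e"
    and v: "(\<lambda>(s, \<omega>). v s \<omega>) \<in> borel_measurable (restrict_space borel {0..T} \<Otimes>\<^sub>M M)"
  shows "forward_approx W T v e \<in> borel_measurable M"
proof -
  obtain V where V: "brownian_increments M V" and eq: "AE \<omega> in M. \<forall>s\<ge>0. V s \<omega> = W s \<omega>"
    by (rule continuous_modification)
  interpret V: brownian_increments M V by fact
  define N where "N = restrict_space lborel {0..T}"
  interpret N: finite_measure N unfolding N_def by (rule finite_measure_restrict_lborel_Icc)
  have sets_N[measurable_cong]: "sets N = sets (restrict_space borel {0..T})"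
    by (simp add: N_def sets_restrict_space)
  have id_N[measurable]: "(\<lambda>s. s) \<in> borel_measurable N"
    unfolding N_def by (intro measurable_restrict_space1) simp
  have f1[measurable]: "fst \<in> borel_measurable (N \<Otimes>\<^sub>M M)"
    using measurable_compose[OF measurable_fst id_N] by simp
  have f2[measurable]: "snd \<in> borel_measurable (M \<Otimes>\<^sub>M N)"
    using measurable_compose[OF measurable_snd id_N] by simp
  have v1[measurable]: "(\<lambda>x. v (f x) (h x)) \<in> borel_measurable L"
    if "f \<in> measurable L N" "h \<in> measurable L M" for L :: "'b measure" and f h
    using measurable_compose[OF measurable_Pair[OF that(1)[unfolded measurable_cong_sets[OF refl sets_N]] that(2)] v]
    by simp
  have "(\<lambda>\<omega>. (1 / e) * (\<integral>s. v s \<omega> * (V (min (s + e) T) \<omega> - V s \<omega>) \<partial>N)) \<in> borel_measurable M"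
    by (intro borel_measurable_times borel_measurable_const N.borel_measurable_lebesgue_integral)
      (simp add: split_beta', measurable)
  moreover have "(\<lambda>\<omega>. (1 / e) * (\<integral>s. v s \<omega> * (V (min (s + e) T) \<omega> - V s \<omega>) \<partial>N)) = forward_approx V T v e"
    unfolding N_def forward_approx_def set_lebesgue_integral_def by (subst integral_restrict_space) simp_all
  ultimately have "forward_approx V T v e \<in> borel_measurable M" by (simp only:)
  then show ?thesis
  proof (rule borel_measurable_AE_eq)
    show "AE \<omega> in M. forward_approx V T v e \<omega> = forward_approx W T v e \<omega>"
      using eq
    proof eventually_elim
      case (elim \<omega>)
      have "(LINT s:{0..T}|lborel. v s \<omega> * (V (min (s + e) T) \<omega> - V s \<omega>))
          = (LINT s:{0..T}|lborel. v s \<omega> * (W (min (s + e) T) \<omega> - W s \<omega>))"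
        by (rule set_lebesgue_integral_cong) (use elim e in auto)
      then show ?case by (simp add: forward_approx_def)
    qed
  qed
qed

text \<open>If convergence in probability failed, there would be step sizes \<open>\<epsilon> n < (1 / 2) ^ n\<close> along which a
  deviation keeps a probability bounded away from zero. They are summable, and almost sure convergence
  along them is a contradiction.\<close>

lemma has_forward_integral_pathwiseI:
  assumes v: "(\<lambda>(s, \<omega>). v s \<omega>) \<in> borel_measurable (restrict_space borel {0..T} \<Otimes>\<^sub>M M)"
    and v_int: "\<And>\<omega>. \<omega> \<in> space M \<Longrightarrow> set_integrable lborel {0..T} (\<lambda>s. v s \<omega>)"
    and lim: "\<And>\<epsilon> :: nat \<Rightarrow> real. (\<And>n. 0 < \<epsilon> n) \<Longrightarrow> summable \<epsilon> \<Longrightarrow>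
      AE \<omega> in M. (\<lambda>n. forward_approx W T v (\<epsilon> n) \<omega>) \<longlonglongrightarrow> Z \<omega>"
  shows "has_forward_integral M W T v Z"
proof -
  have meas[measurable]: "forward_approx W T v e \<in> borel_measurable M" if "0 < e" for e
    using that v by (intro forward_approx_measurable) auto
  have Z: "Z \<in> borel_measurable M"
  proof (rule borel_measurable_AE_eq)
    show "(\<lambda>\<omega>. lim (\<lambda>n. forward_approx W T v ((1 / 2) ^ n) \<omega>)) \<in> borel_measurable M"
      by (intro borel_measurable_lim_metric meas) simp
    have "AE \<omega> in M. (\<lambda>n. forward_approx W T v ((1 / 2) ^ n) \<omega>) \<longlonglongrightarrow> Z \<omega>"
      by (rule lim) (auto intro: summable_geometric)
    then show "AE \<omega> in M. lim (\<lambda>n. forward_approx W T v ((1 / 2) ^ n) \<omega>) = Z \<omega>"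
      by eventually_elim (rule limI)
  qed
  have "((\<lambda>e. measure M {\<omega> \<in> space M. \<delta> < \<bar>forward_approx W T v e \<omega> - Z \<omega>\<bar>}) \<longlongrightarrow> 0) (at_right 0)"
    (is "(?f \<longlongrightarrow> 0) _") if \<delta>: "0 < \<delta>" for \<delta>
  proof (rule ccontr)
    assume "\<not> (?f \<longlongrightarrow> 0) (at_right 0)"
    then obtain r where r: "0 < r" and freq: "\<not> eventually (\<lambda>e. dist (?f e) 0 < r) (at_right 0)"
      unfolding tendsto_iff by auto
    have "\<exists>e. 0 < e \<and> e < (1 / 2) ^ n \<and> \<not> dist (?f e) 0 < r" for n :: nat
    proof (rule ccontr)
      assume "\<nexists>e. 0 < e \<and> e < (1 / 2) ^ n \<and> \<not> dist (?f e) 0 < r"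
      then have *: "dist (?f e) 0 < r" if "0 < e" "e < (1 / 2) ^ n" for e
        using that by blast
      have "eventually (\<lambda>e. e \<in> {0<..<(1 / 2) ^ n}) (at_right (0::real))"
        by (rule eventually_at_right_real) simp
      then have "eventually (\<lambda>e. dist (?f e) 0 < r) (at_right 0)"
        by (rule eventually_mono) (rule *, auto)
      with freq show False ..
    qed
    then obtain \<epsilon> where eps: "\<And>n. 0 < \<epsilon> n" "\<And>n. \<epsilon> n < (1 / 2) ^ n" "\<And>n. \<not> dist (?f (\<epsilon> n)) 0 < r"
      by metis
    have "summable \<epsilon>"
      by (rule summable_comparison_test'[where g = "\<lambda>n. (1 / 2) ^ n" and N = 0])
        (use eps(1)[THEN less_imp_le] eps(2)[THEN less_imp_le] in \<open>auto intro: summable_geometric\<close>)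
    then have "AE \<omega> in M. (\<lambda>n. forward_approx W T v (\<epsilon> n) \<omega>) \<longlonglongrightarrow> Z \<omega>"
      using eps by (intro lim)
    then have "(\<lambda>n. ?f (\<epsilon> n)) \<longlonglongrightarrow> 0"
      using eps Z \<delta> by (intro AE_tendsto_imp_tendsto_measure meas)
    then have "eventually (\<lambda>n. dist (?f (\<epsilon> n)) 0 < r) sequentially" using r by (rule tendstoD)
    then show False using eps(3) by (auto simp: eventually_sequentially)
  qed
  moreover have "eventually (\<lambda>e. forward_approx W T v e \<in> borel_measurable M) (at_right 0)"
    using eventually_at_right_less by eventually_elim (rule meas)
  ultimately show ?thesis
    unfolding has_forward_integral_def tendsto_in_prob_def using v v_int Z by auto
qed

lemma forward_approx_AE_eq:
  assumes u: "(\<lambda>(s, \<omega>). u s \<omega>) \<in> borel_measurable (restrict_space borel {0..T} \<Otimes>\<^sub>M M)"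
    and v: "(\<lambda>(s, \<omega>). v s \<omega>) \<in> borel_measurable (restrict_space borel {0..T} \<Otimes>\<^sub>M M)"
    and eq: "AE (s, \<omega>) in lborel \<Otimes>\<^sub>M M. s \<in> {0..T} \<and> \<omega> \<in> C \<longrightarrow> u s \<omega> = v s \<omega>"
  shows "AE \<omega> in M. \<omega> \<in> C \<longrightarrow> (\<forall>e\<ge>0. forward_approx W T u e \<omega> = forward_approx W T v e \<omega>)"
  using AE_lborel_pair_slices[OF sigma_finite_measure_axioms eq] W_continuous AE_space
proof eventually_elim
  case (elim \<omega>)
  have sec: "set_borel_measurable lborel {0..T} (\<lambda>s. x s \<omega>)"
    if "(\<lambda>(s, \<omega>). x s \<omega>) \<in> borel_measurable (restrict_space borel {0..T} \<Otimes>\<^sub>M M)" for x :: "real \<Rightarrow> 'a \<Rightarrow> real"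
  proof -
    have "(\<lambda>s. x s \<omega>) \<in> borel_measurable (restrict_space borel {0..T})"
      using measurable_Pair1[OF that elim(3)] by simp
    then show ?thesis
      unfolding set_borel_measurable_def
      by (subst (asm) borel_measurable_restrict_space_iff) (auto simp: mult.commute)
  qed
  show ?case
  proof (intro impI allI)
    fix e :: real assume C: "\<omega> \<in> C" and e: "0 \<le> e"
    have cont: "continuous_on {0..T} (\<lambda>s. W (min (s + e) T) \<omega> - W s \<omega>)"
      using e by (intro continuous_intros continuous_on_compose2[OF elim(2)]) auto
    have incr: "set_borel_measurable lborel {0..T} (\<lambda>s. W (min (s + e) T) \<omega> - W s \<omega>)"
      using borel_integrable_atLeastAtMost'[OF cont]
      by (simp add: set_integrable_def set_borel_measurable_def)
    have prod: "set_borel_measurable lborel {0..T} (\<lambda>s. x s * (W (min (s + e) T) \<omega> - W s \<omega>))"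
      if "set_borel_measurable lborel {0..T} (\<lambda>s. x s)" for x :: "real \<Rightarrow> real"
    proof -
      have "(\<lambda>s. (indicator {0..T} s *\<^sub>R x s) * (indicator {0..T} s *\<^sub>R (W (min (s + e) T) \<omega> - W s \<omega>)))
          \<in> borel_measurable lborel"
        using that incr unfolding set_borel_measurable_def by (intro borel_measurable_times)
      moreover have "(\<lambda>s. (indicator {0..T} s *\<^sub>R x s) * (indicator {0..T} s *\<^sub>R (W (min (s + e) T) \<omega> - W s \<omega>)))
          = (\<lambda>s. indicator {0..T} s *\<^sub>R (x s * (W (min (s + e) T) \<omega> - W s \<omega>)))"
        by (auto simp: indicator_def)
      ultimately show ?thesis unfolding set_borel_measurable_def by simp
    qed
    have "(LINT s:{0..T}|lborel. u s \<omega> * (W (min (s + e) T) \<omega> - W s \<omega>))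
        = (LINT s:{0..T}|lborel. v s \<omega> * (W (min (s + e) T) \<omega> - W s \<omega>))"
      unfolding set_lebesgue_integral_def
    proof (rule integral_cong_AE)
      show "AE s in lborel. indicator {0..T} s *\<^sub>R (u s \<omega> * (W (min (s + e) T) \<omega> - W s \<omega>))
          = indicator {0..T} s *\<^sub>R (v s \<omega> * (W (min (s + e) T) \<omega> - W s \<omega>))"
        using elim(1) by eventually_elim (use C in \<open>auto simp: indicator_def\<close>)
    qed (use prod[OF sec[OF u]] prod[OF sec[OF v]] in \<open>simp_all add: set_borel_measurable_def\<close>)
    then show "forward_approx W T u e \<omega> = forward_approx W T v e \<omega>"
      by (simp add: forward_approx_def)
  qed
qed

text \<open>Integrands that agree on \<open>C\<close> have the same approximations on \<open>C\<close>. On the part of \<open>C\<close> where the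
  limits differ by more than \<open>2 * \<delta>\<close>, one of the approximations is further than \<open>\<delta>\<close> from its limit.\<close>

lemma has_forward_integral_local:
  assumes Z: "has_forward_integral M W T u Z" and Z': "has_forward_integral M W T v Z'"
    and C[measurable]: "C \<in> sets M"
    and eq: "AE (s, \<omega>) in lborel \<Otimes>\<^sub>M M. s \<in> {0..T} \<and> \<omega> \<in> C \<longrightarrow> u s \<omega> = v s \<omega>"
  shows "AE \<omega> in M. \<omega> \<in> C \<longrightarrow> Z \<omega> = Z' \<omega>"
proof -
  have [measurable]: "Z \<in> borel_measurable M" "Z' \<in> borel_measurable M"
    and u: "(\<lambda>(s, \<omega>). u s \<omega>) \<in> borel_measurable (restrict_space borel {0..T} \<Otimes>\<^sub>M M)"
    and v: "(\<lambda>(s, \<omega>). v s \<omega>) \<in> borel_measurable (restrict_space borel {0..T} \<Otimes>\<^sub>M M)"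
    using Z Z' by (auto simp: has_forward_integral_def tendsto_in_prob_def)
  have "AE \<omega> in M. \<not> (\<omega> \<in> C \<and> 2 * \<delta> < \<bar>Z \<omega> - Z' \<omega>\<bar>)" if \<delta>: "0 < \<delta>" for \<delta>
  proof -
    define B where "B = {\<omega> \<in> space M. \<omega> \<in> C \<and> 2 * \<delta> < \<bar>Z \<omega> - Z' \<omega>\<bar>}"
    have B[measurable]: "B \<in> sets M" unfolding B_def by measurable
    define f where "f e = measure M {\<omega> \<in> space M. \<delta> < \<bar>forward_approx W T u e \<omega> - Z \<omega>\<bar>}
        + measure M {\<omega> \<in> space M. \<delta> < \<bar>forward_approx W T v e \<omega> - Z' \<omega>\<bar>}" for e
    have "(f \<longlongrightarrow> 0 + 0) (at_right 0)"
      unfolding f_def using Z Z' \<delta>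
      by (intro tendsto_add) (auto simp: has_forward_integral_def tendsto_in_prob_def)
    moreover have "eventually (\<lambda>e. measure M B \<le> f e) (at_right 0)"
      using eventually_at_right_less
    proof eventually_elim
      fix e :: real assume e: "0 < e"
      have [measurable]: "forward_approx W T u e \<in> borel_measurable M"
        "forward_approx W T v e \<in> borel_measurable M"
        using e u v by (auto intro!: forward_approx_measurable)
      let ?B1 = "{\<omega> \<in> space M. \<delta> < \<bar>forward_approx W T u e \<omega> - Z \<omega>\<bar>}"
      let ?B2 = "{\<omega> \<in> space M. \<delta> < \<bar>forward_approx W T v e \<omega> - Z' \<omega>\<bar>}"
      have "measure M B \<le> measure M (?B1 \<union> ?B2)"
      proof (rule finite_measure_mono_AE)
        show "AE \<omega> in M. \<omega> \<in> B \<longrightarrow> \<omega> \<in> ?B1 \<union> ?B2"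
          using forward_approx_AE_eq[OF u v eq]
        proof eventually_elim
          case (elim \<omega>)
          show ?case
          proof
            assume "\<omega> \<in> B"
            then have \<omega>: "\<omega> \<in> space M" "\<omega> \<in> C" "2 * \<delta> < \<bar>Z \<omega> - Z' \<omega>\<bar>" by (auto simp: B_def)
            have "forward_approx W T u e \<omega> = forward_approx W T v e \<omega>"
              using elim \<omega> e by simp
            with \<omega> have "\<delta> < \<bar>forward_approx W T u e \<omega> - Z \<omega>\<bar> \<or> \<delta> < \<bar>forward_approx W T v e \<omega> - Z' \<omega>\<bar>"
              by linarith
            with \<omega> show "\<omega> \<in> ?B1 \<union> ?B2" by auto
          qed
        qed
      qed measurable
      also have "\<dots> \<le> f e" unfolding f_def by (rule measure_Un_le) measurable
      finally show "measure M B \<le> f e" .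
    qed
    ultimately have "measure M B \<le> 0 + 0" by (intro tendsto_lowerbound[of f]) auto
    then have "measure M B = 0" using measure_nonneg[of M B] by linarith
    then have "B \<in> null_sets M" by (auto simp: null_sets_def emeasure_eq_measure)
    then have "AE \<omega> in M. \<omega> \<notin> B" by (rule AE_not_in)
    then show ?thesis using AE_space by eventually_elim (auto simp: B_def)
  qed
  note small = this
  have "AE \<omega> in M. \<forall>n::nat. \<not> (\<omega> \<in> C \<and> 2 * (1 / real (Suc n)) < \<bar>Z \<omega> - Z' \<omega>\<bar>)"
  proof (unfold AE_all_countable, intro allI)
    fix n :: nat
    show "AE \<omega> in M. \<not> (\<omega> \<in> C \<and> 2 * (1 / real (Suc n)) < \<bar>Z \<omega> - Z' \<omega>\<bar>)"
      by (rule small) simp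
  qed
  then show ?thesis
  proof eventually_elim
    case (elim \<omega>)
    show ?case
    proof (rule impI, rule ccontr)
      assume "\<omega> \<in> C" "Z \<omega> \<noteq> Z' \<omega>"
      then obtain n where "1 / real (Suc n) < \<bar>Z \<omega> - Z' \<omega>\<bar> / 2"
        using reals_Archimedean[of "\<bar>Z \<omega> - Z' \<omega>\<bar> / 2"] by (auto simp: inverse_eq_divide)
      with elim \<open>\<omega> \<in> C\<close> show False by (auto simp: field_simps)
    qed
  qed
qed

lemma has_forward_integral_forward_integral:
  "forward_integrable M W T v \<Longrightarrow> has_forward_integral M W T v (forward_integral M W T v)"
  unfolding forward_integrable_def forward_integral_def
  by (rule someI_ex[of "has_forward_integral M W T v"])

text \<open>Any two localizing sequences are compared on the countably many intersections \<open>An n \<inter> Bn m\<close>.\<close>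

lemma has_local_forward_integral_unique:
  assumes Z: "has_local_forward_integral M W T A v Z" and Z': "has_local_forward_integral M W T A v Z'"
  shows "AE \<omega> in M. \<omega> \<in> A \<longrightarrow> Z \<omega> = Z' \<omega>"
proof -
  obtain vn An where vn: "forward_localizing M W T A v vn An"
    and Zn: "\<And>n. AE \<omega> in M. \<omega> \<in> An n \<longrightarrow> Z \<omega> = forward_integral M W T (vn n) \<omega>"
    using Z unfolding has_local_forward_integral_def by blast
  obtain un Bn where un: "forward_localizing M W T A v un Bn"
    and Zn': "\<And>n. AE \<omega> in M. \<omega> \<in> Bn n \<longrightarrow> Z' \<omega> = forward_integral M W T (un n) \<omega>"
    using Z' unfolding has_local_forward_integral_def by blast
  have "AE \<omega> in M. \<omega> \<in> An n \<inter> Bn m \<longrightarrow> forward_integral M W T (vn n) \<omega> = forward_integral M W T (un m) \<omega>"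
    for n m
  proof (rule has_forward_integral_local)
    show "has_forward_integral M W T (vn n) (forward_integral M W T (vn n))"
      "has_forward_integral M W T (un m) (forward_integral M W T (un m))"
      using vn un by (auto simp: forward_localizing_def intro: has_forward_integral_forward_integral)
    show "An n \<inter> Bn m \<in> sets M" using vn un by (auto simp: forward_localizing_def)
    have "AE (s, \<omega>) in lborel \<Otimes>\<^sub>M M. s \<in> {0..T} \<and> \<omega> \<in> An n \<longrightarrow> v s \<omega> = vn n s \<omega>"
      "AE (s, \<omega>) in lborel \<Otimes>\<^sub>M M. s \<in> {0..T} \<and> \<omega> \<in> Bn m \<longrightarrow> v s \<omega> = un m s \<omega>"
      using vn un by (auto simp: forward_localizing_def)
    then show "AE (s, \<omega>) in lborel \<Otimes>\<^sub>M M. s \<in> {0..T} \<and> \<omega> \<in> An n \<inter> Bn m \<longrightarrow> vn n s \<omega> = un m s \<omega>"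
      by eventually_elim auto
  qed
  then have "AE \<omega> in M. \<forall>n m. \<omega> \<in> An n \<inter> Bn m \<longrightarrow>
      forward_integral M W T (vn n) \<omega> = forward_integral M W T (un m) \<omega>"
    by (simp add: AE_all_countable)
  moreover have "AE \<omega> in M. \<forall>n. \<omega> \<in> An n \<longrightarrow> Z \<omega> = forward_integral M W T (vn n) \<omega>"
    "AE \<omega> in M. \<forall>n. \<omega> \<in> Bn n \<longrightarrow> Z' \<omega> = forward_integral M W T (un n) \<omega>"
    using Zn Zn' by (simp_all add: AE_all_countable)
  moreover have "AE \<omega> in M. \<omega> \<in> A \<longleftrightarrow> (\<exists>n. \<omega> \<in> An n)" "AE \<omega> in M. \<omega> \<in> A \<longleftrightarrow> (\<exists>n. \<omega> \<in> Bn n)"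
    using vn un by (auto simp: forward_localizing_def)
  ultimately show ?thesis by eventually_elim auto
qed

text \<open>A localizing sequence may be constant. Since forward integrands need not be adapted, \<open>u\<close> is
  allowed to be cut off outside \<open>A\<close>.\<close>

lemma has_local_forward_integralI:
  assumes Z: "has_forward_integral M W T u Z" and A: "A \<in> sets M"
    and eq: "AE \<omega> in M. \<omega> \<in> A \<longrightarrow> (\<forall>s\<in>{0..T}. v s \<omega> = u s \<omega>)"
  shows "has_local_forward_integral M W T A v Z"
proof -
  have int: "forward_integrable M W T u" using Z by (auto simp: forward_integrable_def)
  have "AE (s, \<omega>) in lborel \<Otimes>\<^sub>M M. s \<in> {0..T} \<and> \<omega> \<in> A \<longrightarrow> v s \<omega> = u s \<omega>"
    using AE_lborel_pair_const[OF sigma_finite_measure_axioms eq] by eventually_elim auto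
  then have "forward_localizing M W T A v (\<lambda>_. u) (\<lambda>_. A)"
    using int A by (simp add: forward_localizing_def)
  moreover have "AE \<omega> in M. \<omega> \<in> UNIV \<inter> space M \<longrightarrow> Z \<omega> = forward_integral M W T u \<omega>"
    by (rule has_forward_integral_local[OF Z has_forward_integral_forward_integral[OF int]]) auto
  then have "AE \<omega> in M. \<omega> \<in> A \<longrightarrow> Z \<omega> = forward_integral M W T u \<omega>"
    using AE_space by eventually_elim auto
  ultimately show ?thesis
    unfolding has_local_forward_integral_def using A by (auto intro!: exI[of _ "\<lambda>_. u"] exI[of _ "\<lambda>_. A"])
qed

lemma has_local_forward_integral_cong:
  assumes Z: "has_local_forward_integral M W T A v Z"
    and eq: "AE \<omega> in M. \<omega> \<in> A \<longrightarrow> (\<forall>s\<in>{0..T}. v s \<omega> = v' s \<omega>)"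
  shows "has_local_forward_integral M W T A v' Z"
proof -
  obtain vn An where vn: "forward_localizing M W T A v vn An"
    and Zn: "\<And>n. AE \<omega> in M. \<omega> \<in> An n \<longrightarrow> Z \<omega> = forward_integral M W T (vn n) \<omega>"
    using Z unfolding has_local_forward_integral_def by blast
  have sub: "AE \<omega> in M. \<omega> \<in> A \<longleftrightarrow> (\<exists>n. \<omega> \<in> An n)"
    using vn by (auto simp: forward_localizing_def)
  have "AE (s, \<omega>) in lborel \<Otimes>\<^sub>M M. s \<in> {0..T} \<and> \<omega> \<in> An n \<longrightarrow> v' s \<omega> = vn n s \<omega>" for n
  proof -
    have "AE \<omega> in M. \<omega> \<in> An n \<longrightarrow> (\<forall>s\<in>{0..T}. v s \<omega> = v' s \<omega>)"
      using eq sub by eventually_elim auto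
    note AE_lborel_pair_const[OF sigma_finite_measure_axioms this]
    moreover have "AE (s, \<omega>) in lborel \<Otimes>\<^sub>M M. s \<in> {0..T} \<and> \<omega> \<in> An n \<longrightarrow> v s \<omega> = vn n s \<omega>"
      using vn by (auto simp: forward_localizing_def)
    ultimately show ?thesis by eventually_elim auto
  qed
  then have "forward_localizing M W T A v' vn An"
    using vn by (simp add: forward_localizing_def)
  then show ?thesis
    using Z Zn unfolding has_local_forward_integral_def by blast
qed

lemma local_forward_integral_AE_eq:
  assumes "has_local_forward_integral M W T A v Z"
  shows "AE \<omega> in M. \<omega> \<in> A \<longrightarrow> local_forward_integral M W T A v \<omega> = Z \<omega>"
proof -
  have "has_local_forward_integral M W T A v (local_forward_integral M W T A v)"
    unfolding local_forward_integral_def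
    using assms by (rule someI[of "has_local_forward_integral M W T A v"])
  then show ?thesis using assms by (rule has_local_forward_integral_unique)
qed

lemma has_local_forward_integral_imp_integrable:
  "has_local_forward_integral M W T A v Z \<Longrightarrow> locally_forward_integrable M W T A v"
  unfolding has_local_forward_integral_def locally_forward_integrable_def by blast

end

section \<open>The power process on the survival set\<close>

text \<open>By continuity the supremum over the interval is one over countably many times.\<close>

lemma (in brownian_increments) borel_measurable_running_maximum:
  assumes T: "0 \<le> T"
  shows "(\<lambda>\<omega>. SUP s\<in>{0..T}. V s \<omega>) \<in> borel_measurable M"
  unfolding borel_measurable_iff_le
proof
  fix a :: real
  define cl where "cl q = max 0 (min q T)" for q :: real
  have cl: "cl q \<in> {0..T}" "q \<in> {0..T} \<Longrightarrow> cl q = q" for q using T by (auto simp: cl_def)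
  have "{\<omega> \<in> space M. (SUP s\<in>{0..T}. V s \<omega>) \<le> a} = {\<omega> \<in> space M. \<forall>q::rat. V (cl (of_rat q)) \<omega> \<le> a}"
  proof (intro Collect_cong conj_cong refl)
    fix \<omega> assume \<omega>: "\<omega> \<in> space M"
    have cont: "continuous_on {0..T} (\<lambda>s. V s \<omega>)"
      by (rule continuous_on_subset[OF V_continuous[OF \<omega>]]) simp
    have bdd: "bdd_above ((\<lambda>s. V s \<omega>) ` {0..T})"
      by (intro bounded_imp_bdd_above compact_imp_bounded compact_continuous_image cont compact_Icc)
    have ne: "{0..T} \<noteq> {}" using T by simp
    have "(SUP s\<in>{0..T}. V s \<omega>) \<le> a \<longleftrightarrow> (\<forall>s\<in>{0..T}. V s \<omega> \<le> a)"
      by (rule cSUP_le_iff[OF ne bdd])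
    also have "\<dots> \<longleftrightarrow> (\<forall>q::rat. V (cl (of_rat q)) \<omega> \<le> a)"
    proof
      assume q: "\<forall>q::rat. V (cl (of_rat q)) \<omega> \<le> a"
      have "closed {s. V (cl s) \<omega> \<le> a}"
        unfolding cl_def
        by (intro closed_Collect_le continuous_intros continuous_on_compose2[OF V_continuous[OF \<omega>]]) auto
      moreover have "\<rat> \<subseteq> {s. V (cl s) \<omega> \<le> a}" using q by (auto elim!: Rats_cases)
      ultimately have "closure \<rat> \<subseteq> {s. V (cl s) \<omega> \<le> a}" by (intro closure_minimal)
      then have "V (cl s) \<omega> \<le> a" for s unfolding Rats_closure_real by auto
      then show "\<forall>s\<in>{0..T}. V s \<omega> \<le> a" using cl(2) by metis
    qed (use cl in auto)
    finally show "(SUP s\<in>{0..T}. V s \<omega>) \<le> a \<longleftrightarrow> (\<forall>q::rat. V (cl (of_rat q)) \<omega> \<le> a)" .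
  qed
  also have "\<dots> \<in> sets M" by measurable
  finally show "{\<omega> \<in> space M. (SUP s\<in>{0..T}. V s \<omega>) \<le> a} \<in> sets M" .
qed

lemma survival_set_base_positive:
  assumes \<omega>: "\<omega> \<in> survival_set M W c\<^sub>1 c\<^sub>2 p I T" and cont: "continuous_on {0..T} (\<lambda>s. W s \<omega>)"
    and c: "0 \<le> c\<^sub>1" "0 \<le> c\<^sub>2" "1 \<le> p" and s: "s \<in> {0..T}"
  shows "0 < I \<omega> powr (1 - p) - c\<^sub>1 * (p - 1) * s - c\<^sub>2 * (p - 1) * W s \<omega>"
proof -
  have bdd: "bdd_above ((\<lambda>s. W s \<omega>) ` {0..T})"
    by (intro bounded_imp_bdd_above compact_imp_bounded compact_continuous_image cont compact_Icc)
  have "c\<^sub>2 * (p - 1) * W s \<omega> \<le> c\<^sub>2 * (p - 1) * (SUP s\<in>{0..T}. W s \<omega>)"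
    using c by (intro mult_left_mono cSUP_upper[OF s bdd]) auto
  moreover have "c\<^sub>1 * (p - 1) * s \<le> c\<^sub>1 * (p - 1) * T"
    using c s by (intro mult_left_mono) auto
  moreover have "0 < I \<omega> powr (1 - p) - c\<^sub>1 * (p - 1) * T - c\<^sub>2 * (p - 1) * (SUP s\<in>{0..T}. W s \<omega>)"
    using \<omega> by (simp add: survival_set_def)
  ultimately show ?thesis by linarith
qed

lemma survival_set_cong:
  assumes "\<And>s. s \<in> {0..T} \<Longrightarrow> V s \<omega> = W s \<omega>"
  shows "\<omega> \<in> survival_set M V c\<^sub>1 c\<^sub>2 p I T \<longleftrightarrow> \<omega> \<in> survival_set M W c\<^sub>1 c\<^sub>2 p I T"
proof -
  have "(SUP s\<in>{0..T}. V s \<omega>) = (SUP s\<in>{0..T}. W s \<omega>)"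
    using assms by (intro SUP_cong) auto
  then show ?thesis by (simp add: survival_set_def)
qed

lemma L_base_eq:
  assumes "0 < x"
  shows "L_base W c\<^sub>1 c\<^sub>2 p x s \<omega> = x powr (1 - p) - c\<^sub>1 * (p - 1) * s - c\<^sub>2 * (p - 1) * W s \<omega>"
proof -
  have "(1 / x) powr (p - 1) = x powr (- (p - 1))"
    using assms powr_minus_divide[of x "p - 1"] by (simp add: powr_divide)
  then show ?thesis by (simp add: L_base_def)
qed

context brownian_motion
begin

lemma survival_set_measurable:
  assumes I[measurable]: "I \<in> borel_measurable M" and T: "0 \<le> T"
  shows "survival_set M W c\<^sub>1 c\<^sub>2 p I T \<in> sets M"
proof -
  obtain V where V: "brownian_increments M V" and eq: "AE \<omega> in M. \<forall>s\<ge>0. V s \<omega> = W s \<omega>"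
    by (rule continuous_modification)
  interpret V: brownian_increments M V by fact
  have [measurable]: "(\<lambda>\<omega>. SUP s\<in>{0..T}. V s \<omega>) \<in> borel_measurable M"
    by (rule V.borel_measurable_running_maximum[OF T])
  show ?thesis
  proof (rule in_sets_AE)
    show "survival_set M V c\<^sub>1 c\<^sub>2 p I T \<in> sets M" unfolding survival_set_def by measurable
    show "AE \<omega> in M. \<omega> \<in> survival_set M V c\<^sub>1 c\<^sub>2 p I T \<longleftrightarrow> \<omega> \<in> survival_set M W c\<^sub>1 c\<^sub>2 p I T"
      using eq by eventually_elim (rule survival_set_cong, auto)
  qed (auto simp: survival_set_def)
qed

text \<open>The base is bounded away from zero on \<open>[0, t]\<close> along each path in the survival set. The integrand
  multiplied by the indicator of that set therefore has continuous paths, and is itself forward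
  integrable by the pathwise formula. It serves as a localizing sequence of one member.\<close>

lemma power_process_has_local_forward_integral:
  fixes c\<^sub>1 c\<^sub>2 p \<kappa> t T :: real and I :: "'a \<Rightarrow> real"
  assumes c: "0 < c\<^sub>1" "0 < c\<^sub>2" "1 < p" and t: "0 \<le> t" "t \<le> T"
    and I[measurable]: "I \<in> borel_measurable M"
  defines "X \<equiv> \<lambda>s \<omega>. I \<omega> powr (1 - p) - c\<^sub>1 * (p - 1) * s - c\<^sub>2 * (p - 1) * W s \<omega>"
  obtains Z where
    "has_local_forward_integral M W t (survival_set M W c\<^sub>1 c\<^sub>2 p I T)
      (\<lambda>s \<omega>. \<kappa> * X s \<omega> powr (p / (1 - p))) Z"
    "AE \<omega> in M. \<omega> \<in> survival_set M W c\<^sub>1 c\<^sub>2 p I T \<longrightarrow> Z \<omega> =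
      \<kappa> / c\<^sub>2 * (X t \<omega> powr (1 / (1 - p)) - X 0 \<omega> powr (1 / (1 - p))
        - (LINT s:{0..t}|lborel. c\<^sub>1 * X s \<omega> powr (p / (1 - p))
            + p * c\<^sub>2\<^sup>2 / 2 * X s \<omega> powr ((2 * p - 1) / (1 - p))))"
proof -
  obtain V where V: "brownian_increments M V" and eq: "AE \<omega> in M. \<forall>s\<ge>0. V s \<omega> = W s \<omega>"
    by (rule continuous_modification)
  interpret V: brownian_increments M V by fact
  have [measurable]: "(\<lambda>\<omega>. SUP s\<in>{0..T}. V s \<omega>) \<in> borel_measurable M"
    using t by (intro V.borel_measurable_running_maximum) auto
  define A where "A = survival_set M W c\<^sub>1 c\<^sub>2 p I T"
  define A' where "A' = survival_set M V c\<^sub>1 c\<^sub>2 p I T"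
  have A: "A \<in> sets M" unfolding A_def using t by (intro survival_set_measurable) auto
  have A'[measurable]: "A' \<in> sets M"
    unfolding A'_def survival_set_def by measurable
  have A'_space: "\<omega> \<in> space M" if "\<omega> \<in> A'" for \<omega> using that by (auto simp: A'_def survival_set_def)
  have A_A': "AE \<omega> in M. \<omega> \<in> A' \<longleftrightarrow> \<omega> \<in> A"
    unfolding A_def A'_def using eq by eventually_elim (rule survival_set_cong, auto)
  define Y where "Y s \<omega> = I \<omega> powr (1 - p) - c\<^sub>1 * (p - 1) * s - c\<^sub>2 * (p - 1) * V s \<omega>" for s \<omega>
  have Y_X: "AE \<omega> in M. \<forall>s\<ge>0. Y s \<omega> = X s \<omega>"
    using eq by eventually_elim (auto simp: X_def Y_def)
  have V_cont: "continuous_on B (\<lambda>s. V s \<omega>)" if "\<omega> \<in> space M" for \<omega> B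
    by (rule continuous_on_subset[OF V.V_continuous[OF that]]) simp
  have Y_pos: "0 < Y s \<omega>" if "\<omega> \<in> A'" "s \<in> {0..T}" for s \<omega>
    unfolding Y_def using that c A'_space
    by (intro survival_set_base_positive[of \<omega> M V c\<^sub>1 c\<^sub>2 p I T] V_cont) (auto simp: A'_def)
  have Y_pow: "continuous_on {0..t} (\<lambda>s. Y s \<omega> powr r)" if "\<omega> \<in> A'" for \<omega> r
  proof (intro continuous_intros)
    show "continuous_on {0..t} (\<lambda>s. Y s \<omega>)"
      unfolding Y_def by (intro continuous_intros V_cont A'_space that)
    show "\<forall>s\<in>{0..t}. Y s \<omega> \<noteq> 0" using Y_pos[OF that] t by force
  qed
  define drift where "drift s \<omega> = c\<^sub>1 * Y s \<omega> powr (p / (1 - p))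
            + p * c\<^sub>2\<^sup>2 / 2 * Y s \<omega> powr ((2 * p - 1) / (1 - p))" for s \<omega>
  have drift_cont: "continuous_on {0..t} (\<lambda>s. drift s \<omega>)" if "\<omega> \<in> A'" for \<omega>
    unfolding drift_def by (intro continuous_intros Y_pow that)
  define u where "u s \<omega> = (if \<omega> \<in> A' then \<kappa> * Y s \<omega> powr (p / (1 - p)) else 0)" for s \<omega>
  define Z where "Z \<omega> = (if \<omega> \<in> A' then \<kappa> * ((Y t \<omega> powr (1 / (1 - p)) - Y 0 \<omega> powr (1 / (1 - p))
        - integral {0..t} (\<lambda>s. drift s \<omega>)) / c\<^sub>2) else 0)" for \<omega>
  have "has_forward_integral M W t u Z"
  proof (rule has_forward_integral_pathwiseI)
    have [measurable]: "fst \<in> borel_measurable (restrict_space borel {0..t} \<Otimes>\<^sub>M M)"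
      by (rule measurable_compose[OF measurable_fst measurable_restrict_space1]) simp
    show "(\<lambda>(s, \<omega>). u s \<omega>) \<in> borel_measurable (restrict_space borel {0..t} \<Otimes>\<^sub>M M)"
      unfolding u_def Y_def split_beta' by measurable
    show "set_integrable lborel {0..t} (\<lambda>s. u s \<omega>)" for \<omega>
      by (cases "\<omega> \<in> A'")
        (auto simp: u_def intro!: borel_integrable_atLeastAtMost' continuous_intros Y_pow)
  next
    fix \<epsilon> :: "nat \<Rightarrow> real" assume eps: "\<And>n. 0 < \<epsilon> n" "summable \<epsilon>"
    show "AE \<omega> in M. (\<lambda>n. forward_approx W t u (\<epsilon> n) \<omega>) \<longlonglongrightarrow> Z \<omega>"
      using V.AE_weighted_quadratic_variation[OF t(1) eps] eq
    proof eventually_elim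
      case (elim \<omega>)
      show ?case
      proof (cases "\<omega> \<in> A'")
        case False
        then show ?thesis by (simp add: forward_approx_def u_def Z_def set_lebesgue_integral_def)
      next
        case True
        have cont: "continuous_on {0..t} (\<lambda>s. V s \<omega>)" by (intro V_cont A'_space True)
        have lim: "(\<lambda>n. integral {0..t} (\<lambda>s. Y s \<omega> powr (p / (1 - p)) * ((V (min (s + \<epsilon> n) t) \<omega> - V s \<omega>) / \<epsilon> n)))
            \<longlonglongrightarrow> (Y t \<omega> powr (1 / (1 - p)) - Y 0 \<omega> powr (1 / (1 - p))
                - integral {0..t} (\<lambda>s. drift s \<omega>)) / c\<^sub>2"
          unfolding drift_def Y_def
          by (rule pathwise_power_ito[OF t(1) cont c(3,2) eps(1) summable_LIMSEQ_zero[OF eps(2)]])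
            (use elim(1) Y_pos[OF True] t in \<open>auto simp: Y_def\<close>)
        have "forward_approx W t u (\<epsilon> n) \<omega>
            = \<kappa> * integral {0..t} (\<lambda>s. Y s \<omega> powr (p / (1 - p)) * ((V (min (s + \<epsilon> n) t) \<omega> - V s \<omega>) / \<epsilon> n))" for n
        proof -
          have "forward_approx W t u (\<epsilon> n) \<omega>
              = (1 / \<epsilon> n) * (LINT s:{0..t}|lborel. (\<kappa> * \<epsilon> n) * (Y s \<omega> powr (p / (1 - p)) * ((V (min (s + \<epsilon> n) t) \<omega> - V s \<omega>) / \<epsilon> n)))"
            unfolding forward_approx_def
            using elim(2) eps(1)[of n] t True
            by (intro arg_cong2[where f = "(*)"] refl set_lebesgue_integral_cong) (auto simp: u_def)
          also have "\<dots> = \<kappa> * (LINT s:{0..t}|lborel. Y s \<omega> powr (p / (1 - p)) * ((V (min (s + \<epsilon> n) t) \<omega> - V s \<omega>) / \<epsilon> n))"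
            using eps(1)[of n] by (subst set_integral_mult_right) simp
          also have "(LINT s:{0..t}|lborel. Y s \<omega> powr (p / (1 - p)) * ((V (min (s + \<epsilon> n) t) \<omega> - V s \<omega>) / \<epsilon> n))
             = integral {0..t} (\<lambda>s. Y s \<omega> powr (p / (1 - p)) * ((V (min (s + \<epsilon> n) t) \<omega> - V s \<omega>) / \<epsilon> n))"
            using eps(1)[of n]
            by (intro set_integral_continuous_eq_integral continuous_intros Y_pow True
              continuous_on_compose2[OF V.V_continuous[OF A'_space[OF True]]]) auto
          finally show ?thesis .
        qed
        then show ?thesis
          using tendsto_mult_left[OF lim, of \<kappa>] True by (simp add: Z_def)
      qed
    qed
  qed
  then have 1: "has_local_forward_integral M W t A (\<lambda>s \<omega>. \<kappa> * X s \<omega> powr (p / (1 - p))) Z"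
  proof (rule has_local_forward_integralI[OF _ A])
    show "AE \<omega> in M. \<omega> \<in> A \<longrightarrow> (\<forall>s\<in>{0..t}. \<kappa> * X s \<omega> powr (p / (1 - p)) = u s \<omega>)"
      using A_A' Y_X by eventually_elim (auto simp: u_def)
  qed
  have 2: "AE \<omega> in M. \<omega> \<in> A \<longrightarrow> Z \<omega> =
      \<kappa> / c\<^sub>2 * (X t \<omega> powr (1 / (1 - p)) - X 0 \<omega> powr (1 / (1 - p))
        - (LINT s:{0..t}|lborel. c\<^sub>1 * X s \<omega> powr (p / (1 - p))
            + p * c\<^sub>2\<^sup>2 / 2 * X s \<omega> powr ((2 * p - 1) / (1 - p))))"
    using A_A' Y_X
  proof eventually_elim
    case (elim \<omega>)
    show ?case
    proof
      assume "\<omega> \<in> A"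
      then have \<omega>: "\<omega> \<in> A'" using elim by simp
      have "integral {0..t} (\<lambda>s. drift s \<omega>) = (LINT s:{0..t}|lborel. drift s \<omega>)"
        by (rule set_integral_continuous_eq_integral[OF drift_cont[OF \<omega>], symmetric])
      also have "\<dots> = (LINT s:{0..t}|lborel. c\<^sub>1 * X s \<omega> powr (p / (1 - p))
            + p * c\<^sub>2\<^sup>2 / 2 * X s \<omega> powr ((2 * p - 1) / (1 - p)))"
        using elim by (intro set_lebesgue_integral_cong) (auto simp: drift_def)
      finally show "Z \<omega> = \<kappa> / c\<^sub>2 * (X t \<omega> powr (1 / (1 - p)) - X 0 \<omega> powr (1 / (1 - p))
        - (LINT s:{0..t}|lborel. c\<^sub>1 * X s \<omega> powr (p / (1 - p))
            + p * c\<^sub>2\<^sup>2 / 2 * X s \<omega> powr ((2 * p - 1) / (1 - p))))"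
        using elim \<omega> t by (simp add: Z_def)
    qed
  qed
  show thesis using 1 2 unfolding A_def by (rule that)
qed

end

theorem theorem1p1:
  fixes M :: "'a measure" and F :: "real \<Rightarrow> 'a measure" and W :: "real \<Rightarrow> 'a \<Rightarrow> real"
    and I :: "'a \<Rightarrow> real" and c\<^sub>1 c\<^sub>2 p tbar :: real
  assumes "brownian_motion M F W"
    and "c\<^sub>1 > 0" and "c\<^sub>2 > 0" and "p > 1" and "tbar > 0"
    and "I \<in> borel_measurable M" and "AE \<omega> in M. I \<omega> > 0"
  shows "(\<forall>t\<in>{0<..tbar}.
            locally_forward_integrable M W t (survival_set M W c\<^sub>1 c\<^sub>2 p I tbar)
              (\<lambda>s \<omega>. (I \<omega> powr (1 - p) - c\<^sub>1 * (p - 1) * s - c\<^sub>2 * (p - 1) * W s \<omega>)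
                       powr (p / (1 - p))))
       \<and> (\<forall>t\<in>{0..tbar}.
            (AE \<omega> in M. \<omega> \<in> survival_set M W c\<^sub>1 c\<^sub>2 p I tbar \<longrightarrow>
               (\<forall>s\<in>{0..t}. L_base W c\<^sub>1 c\<^sub>2 p (I \<omega>) s \<omega> > 0) \<and>
               set_integrable lborel {0..t}
                 (\<lambda>s. c\<^sub>1 * L W c\<^sub>1 c\<^sub>2 p (I \<omega>) s \<omega> powr p
                    + p * c\<^sub>2\<^sup>2 / 2 * L W c\<^sub>1 c\<^sub>2 p (I \<omega>) s \<omega> powr (2 * p - 1)))
          \<and> locally_forward_integrable M W t (survival_set M W c\<^sub>1 c\<^sub>2 p I tbar)
              (\<lambda>s \<omega>. c\<^sub>2 * L W c\<^sub>1 c\<^sub>2 p (I \<omega>) s \<omega> powr p)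
          \<and> (AE \<omega> in M. \<omega> \<in> survival_set M W c\<^sub>1 c\<^sub>2 p I tbar \<longrightarrow>
               L W c\<^sub>1 c\<^sub>2 p (I \<omega>) t \<omega> =
                 I \<omega>
                 + (LINT s:{0..t}|lborel.
                      c\<^sub>1 * L W c\<^sub>1 c\<^sub>2 p (I \<omega>) s \<omega> powr p
                      + p * c\<^sub>2\<^sup>2 / 2 * L W c\<^sub>1 c\<^sub>2 p (I \<omega>) s \<omega> powr (2 * p - 1))
                 + local_forward_integral M W t (survival_set M W c\<^sub>1 c\<^sub>2 p I tbar)
                     (\<lambda>s \<omega>. c\<^sub>2 * L W c\<^sub>1 c\<^sub>2 p (I \<omega>) s \<omega> powr p) \<omega>))"
proof -
  interpret brownian_motion M F W by fact
  note c = assms(2-4)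
  define A where "A = survival_set M W c\<^sub>1 c\<^sub>2 p I tbar"
  define X where "X s \<omega> = I \<omega> powr (1 - p) - c\<^sub>1 * (p - 1) * s - c\<^sub>2 * (p - 1) * W s \<omega>" for s \<omega>
  have L_base_X: "L_base W c\<^sub>1 c\<^sub>2 p (I \<omega>) s \<omega> = X s \<omega>" if "0 < I \<omega>" for s \<omega>
    using L_base_eq[OF that] by (simp add: X_def)
  have L_X: "L W c\<^sub>1 c\<^sub>2 p (I \<omega>) s \<omega> = X s \<omega> powr (1 / (1 - p))" if "0 < I \<omega>" for s \<omega>
    using that by (simp add: L_def L_base_X)
  have L_pow: "L W c\<^sub>1 c\<^sub>2 p (I \<omega>) s \<omega> powr p = X s \<omega> powr (p / (1 - p))"
    "L W c\<^sub>1 c\<^sub>2 p (I \<omega>) s \<omega> powr (2 * p - 1) = X s \<omega> powr ((2 * p - 1) / (1 - p))" if "0 < I \<omega>" for s \<omega>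
    using that by (simp_all add: L_X powr_powr)
  have A: "A \<in> sets M" unfolding A_def using assms by (intro survival_set_measurable) auto
  have X_pos: "0 < X s \<omega>" if "\<omega> \<in> A" "continuous_on {0..} (\<lambda>s. W s \<omega>)" "s \<in> {0..tbar}" for s \<omega>
    unfolding X_def using that c
    by (intro survival_set_base_positive[of \<omega> M W c\<^sub>1 c\<^sub>2 p I tbar])
      (auto simp: A_def intro: continuous_on_subset)
  have part1: "locally_forward_integrable M W t A (\<lambda>s \<omega>. X s \<omega> powr (p / (1 - p)))"
    if "t \<in> {0<..tbar}" for t
  proof -
    have t: "0 \<le> t" "t \<le> tbar" using that by auto
    obtain Z where "has_local_forward_integral M W t A (\<lambda>s \<omega>. 1 * X s \<omega> powr (p / (1 - p))) Z"
      unfolding A_def X_def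
      by (rule power_process_has_local_forward_integral[OF c t assms(6), where \<kappa> = 1])
    then show ?thesis using has_local_forward_integral_imp_integrable by simp
  qed
  have part2: "AE \<omega> in M. \<omega> \<in> A \<longrightarrow>
       (\<forall>s\<in>{0..t}. L_base W c\<^sub>1 c\<^sub>2 p (I \<omega>) s \<omega> > 0) \<and>
       set_integrable lborel {0..t}
         (\<lambda>s. c\<^sub>1 * L W c\<^sub>1 c\<^sub>2 p (I \<omega>) s \<omega> powr p
            + p * c\<^sub>2\<^sup>2 / 2 * L W c\<^sub>1 c\<^sub>2 p (I \<omega>) s \<omega> powr (2 * p - 1))"
    if t: "t \<in> {0..tbar}" for t
    using W_continuous assms(7)
  proof eventually_elim
    case (elim \<omega>)
    show ?case
    proof (intro impI conjI)
      assume \<omega>: "\<omega> \<in> A"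
      have pos: "0 < X s \<omega>" if "s \<in> {0..t}" for s using X_pos[OF \<omega> elim(1)] that t by auto
      then show "\<forall>s\<in>{0..t}. L_base W c\<^sub>1 c\<^sub>2 p (I \<omega>) s \<omega> > 0" using elim(2) by (simp add: L_base_X)
      have "continuous_on {0..t} (\<lambda>s. X s \<omega>)"
        unfolding X_def using elim(1) by (intro continuous_intros) (auto intro: continuous_on_subset)
      moreover have "\<forall>s\<in>{0..t}. X s \<omega> \<noteq> 0" using pos by force
      ultimately have pow: "continuous_on {0..t} (\<lambda>s. X s \<omega> powr r)" for r by (intro continuous_intros)
      show "set_integrable lborel {0..t}
         (\<lambda>s. c\<^sub>1 * L W c\<^sub>1 c\<^sub>2 p (I \<omega>) s \<omega> powr p
            + p * c\<^sub>2\<^sup>2 / 2 * L W c\<^sub>1 c\<^sub>2 p (I \<omega>) s \<omega> powr (2 * p - 1))"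
        unfolding L_pow[OF elim(2)]
        by (intro borel_integrable_atLeastAtMost' continuous_on_add continuous_on_mult continuous_on_const pow)
    qed
  qed
  have part3: "locally_forward_integrable M W t A (\<lambda>s \<omega>. c\<^sub>2 * L W c\<^sub>1 c\<^sub>2 p (I \<omega>) s \<omega> powr p)
      \<and> (AE \<omega> in M. \<omega> \<in> A \<longrightarrow> L W c\<^sub>1 c\<^sub>2 p (I \<omega>) t \<omega> = I \<omega>
         + (LINT s:{0..t}|lborel. c\<^sub>1 * L W c\<^sub>1 c\<^sub>2 p (I \<omega>) s \<omega> powr p
              + p * c\<^sub>2\<^sup>2 / 2 * L W c\<^sub>1 c\<^sub>2 p (I \<omega>) s \<omega> powr (2 * p - 1))
         + local_forward_integral M W t A (\<lambda>s \<omega>. c\<^sub>2 * L W c\<^sub>1 c\<^sub>2 p (I \<omega>) s \<omega> powr p) \<omega>)"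
    if "t \<in> {0..tbar}" for t
  proof -
    have t: "0 \<le> t" "t \<le> tbar" using that by auto
    obtain Z where Z: "has_local_forward_integral M W t A (\<lambda>s \<omega>. c\<^sub>2 * X s \<omega> powr (p / (1 - p))) Z"
      and Z_eq: "AE \<omega> in M. \<omega> \<in> A \<longrightarrow> Z \<omega> =
        c\<^sub>2 / c\<^sub>2 * (X t \<omega> powr (1 / (1 - p)) - X 0 \<omega> powr (1 / (1 - p))
          - (LINT s:{0..t}|lborel. c\<^sub>1 * X s \<omega> powr (p / (1 - p))
              + p * c\<^sub>2\<^sup>2 / 2 * X s \<omega> powr ((2 * p - 1) / (1 - p))))"
      unfolding A_def X_def
      by (rule power_process_has_local_forward_integral[OF c t assms(6), where \<kappa> = c\<^sub>2])
    have L: "has_local_forward_integral M W t A (\<lambda>s \<omega>. c\<^sub>2 * L W c\<^sub>1 c\<^sub>2 p (I \<omega>) s \<omega> powr p) Z"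
    proof (rule has_local_forward_integral_cong[OF Z])
      show "AE \<omega> in M. \<omega> \<in> A \<longrightarrow> (\<forall>s\<in>{0..t}. c\<^sub>2 * X s \<omega> powr (p / (1 - p))
          = c\<^sub>2 * L W c\<^sub>1 c\<^sub>2 p (I \<omega>) s \<omega> powr p)"
        using assms(7) by eventually_elim (simp add: L_pow)
    qed
    moreover have "AE \<omega> in M. \<omega> \<in> A \<longrightarrow> L W c\<^sub>1 c\<^sub>2 p (I \<omega>) t \<omega> = I \<omega>
         + (LINT s:{0..t}|lborel. c\<^sub>1 * L W c\<^sub>1 c\<^sub>2 p (I \<omega>) s \<omega> powr p
              + p * c\<^sub>2\<^sup>2 / 2 * L W c\<^sub>1 c\<^sub>2 p (I \<omega>) s \<omega> powr (2 * p - 1))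
         + local_forward_integral M W t A (\<lambda>s \<omega>. c\<^sub>2 * L W c\<^sub>1 c\<^sub>2 p (I \<omega>) s \<omega> powr p) \<omega>"
      using local_forward_integral_AE_eq[OF L] Z_eq assms(7) W_zero
    proof eventually_elim
      case (elim \<omega>)
      have "X 0 \<omega> powr (1 / (1 - p)) = I \<omega>"
        using elim c by (simp add: X_def powr_powr)
      then show ?case
        using elim c by (simp add: L_X L_pow powr_powr)
    qed
    ultimately show ?thesis using has_local_forward_integral_imp_integrable by blast
  qed
  show ?thesis
    unfolding A_def[symmetric] X_def[symmetric] using part1 part2 part3 by blast
qed

end
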